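(* Let $(\mathcal X,d,\mu)$ be a space of homogeneous type. Let $\beta,\gamma\in(0,\eta)$ and $s\in(-(\beta\wedge\gamma),\beta\wedge\gamma)$ satisfy $$(\ast)\qquad\beta\in((-s)_+,\eta)\quad\text{and}\quad\gamma\in(0,\eta),$$ and let $q\in(p(s,\beta\wedge\gamma),\infty]$. Let $\widetilde\beta,\widetilde\gamma$ satisfy $s\in(-(\widetilde\beta\wedge\widetilde\gamma),\widetilde\beta\wedge\widetilde\gamma)$, $q\in(p(s,\widetilde\beta\wedge\widetilde\gamma),\infty]$ and $(\ast)$ with $\beta,\gamma$ replaced by $\widetilde\beta,\widetilde\gamma$. Then, for any $f\in F^s_{\infty,q}(\mathcal X)\subset(\mathcal G^\eta_0(\beta,\gamma))'$, one has $f\in(\mathcal G^\eta_0(\widetilde\beta,\widetilde\gamma))'$, and there exists a positive constant $C$, independent of $f$, such that $$\|f\|_{(\mathcal G^\eta_0(\widetilde\beta,\widetilde\gamma))'}\le C\|f\|_{F^s_{\infty,q}(\mathcal X)}.$$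
   Context: Space. $d$ is a quasi-metric on $\mathcal X$: $d\ge0$, $d(x,y)=0$ iff $x=y$, $d$ symmetric, $d(x,z)\le A_0[d(x,y)+d(y,z)]$ for some $A_0\in[1,\infty)$. $B(x,r):=\{y:d(x,y)<r\}$. $(\mathcal X,d,\mu)$ is a space of homogeneous type: $\mu$ is a measure for which balls are measurable with $0<\mu(B)<\infty$, and $\mu(2B)\le C_{(\mu)}\mu(B)$ for every ball $B$; $\omega:=\log_2C_{(\mu)}$. $\mu(\mathcal X)$ may be finite or infinite. $V_r(x):=\mu(B(x,r))$, $V(x,y):=\mu(B(x,d(x,y)))$ ($=0$ if $x=y$). $a\wedge b:=\min\{a,b\}$, $r_+:=\max\{r,0\}$. $m_E(g):=\frac1{\mu(E)}\int_Eg\,d\mu$. $\mathbb Z_+=\{0,1,2,\dots\}$, $\mathbb N=\{1,2,\dots\}$. Dyadic cubes. Fix $0<c_0\le C_0<\infty$, a small $\delta\in(0,1)$ (e.g. $\delta\le(2A_0)^{-10}$) with $12A_0^3C_0\delta\le c_0$, and points $\{z^k_\alpha:k\in\mathbb Z,\alpha\in\mathcal A_k\}$, nested ($\mathcal A_k\subset\mathcal A_{k+1}$ and $z^{k+1}_\alpha=z^k_\alpha$ for $\alpha\in\mathcal A_k$), with $d(z^k_\alpha,z^k_\beta)\ge c_0\delta^k$ if $\alpha\ne\beta$ and $\min_{\alpha\in\mathcal A_k}d(x,z^k_\alpha)<C_0\delta^k$ for all $x$. $\mathcal Y^k:=\{z^{k+1}_\alpha:\alpha\in\mathcal A_{k+1}\setminus\mathcal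 A_k\}$, $d(x,\mathcal Y^k):=\inf_{y\in\mathcal Y^k}d(x,y)$. $\{Q^k_\alpha\}$ is an associated (Hytönen–Kairema) system of dyadic cubes: for each $k$, $\{Q^k_\alpha\}_{\alpha\in\mathcal A_k}$ is disjoint with union $\mathcal X$; for $k\le l$ each $Q^l_\beta$ is contained in or disjoint from each $Q^k_\alpha$; $B(z^k_\alpha,(3A_0^2)^{-1}c_0\delta^k)\subset Q^k_\alpha\subset B(z^k_\alpha,2A_0C_0\delta^k)$. Fix $j_0\in\mathbb N$ large with $\delta^{j_0}\le(2A_0)^{-3}C_0$; $\{Q^{k,m}_\alpha\}_{m=1}^{N(k,\alpha)}$ enumerates the cubes $Q^{k+j_0}_\tau$ contained in $Q^k_\alpha$. exp-IATI. $\eta\in(0,1)$ is a fixed exponent for which such approximations exist on $\mathcal X$. Put $$E_k(x,y):=\frac{1}{\sqrt{V_{\delta^k}(x)V_{\delta^k}(y)}}\exp\Big\{-\nu\Big[\frac{d(x,y)}{\delta^k}\Big]^a\Big\}\exp\Big\{-\nu\Big[\frac{\max\{d(x,\mathcal Y^k),d(y,\mathcal Y^k)\}}{\delta^k}\Big]^a\Big\}.$$ An exp-IATI is a sequence $\{Q_k\}_{k\in\mathbb Z_+}$ of bounded linear integral operators on $L^2(\mathcal X)$, with kernels $Q_k(x,y)$, with $\sum_{k=0}^\infty Q_k=I$ in $L^2(\mathcal X)$, such that for some constants $C,\nu\in(0,\infty)$, $a\in(0,1]$, for all $k\in\mathbb N$ and all points: (a) $|Q_k(x,y)|\le CE_k(x,y)$;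 (b) if $d(x,x')\le\delta^k$, then $|Q_k(x,y)-Q_k(x',y)|+|Q_k(y,x)-Q_k(y,x')|\le C[d(x,x')/\delta^k]^\eta E_k(x,y)$; (c) if $d(x,x')\le\delta^k$ and $d(y,y')\le\delta^k$, then $|[Q_k(x,y)-Q_k(x',y)]-[Q_k(x,y')-Q_k(x',y')]|\le C[d(x,x')/\delta^k]^\eta[d(y,y')/\delta^k]^\eta E_k(x,y)$; (d) $\int Q_k(x,y)\,d\mu(y)=0=\int Q_k(y,x)\,d\mu(y)$; while $Q_0$ satisfies (a)–(c) with $k=0$ and with the second exponential factor removed from $E_0$, and $\int Q_0(x,y)\,d\mu(y)=1=\int Q_0(y,x)\,d\mu(y)$. Test functions and distributions. Fix $x_0\in\mathcal X$. For $\beta\in(0,1]$, $\gamma\in(0,\infty)$, $\mathcal G(\beta,\gamma)$ is the set of functions $f$ for which there is $C>0$ such that, with $D_\gamma(x):=\frac{1}{V_1(x_0)+V(x_0,x)}[1+d(x_0,x)]^{-\gamma}$: $|f(x)|\le CD_\gamma(x)$ for all $x$, and $|f(x)-f(y)|\le C[\frac{d(x,y)}{1+d(x_0,x)}]^\beta D_\gamma(x)$ whenever $d(x,y)\le(2A_0)^{-1}[1+d(x_0,x)]$; its norm is the infimum of such $C$. For $\beta,\gamma\in(0,\eta]$, $\mathcal G^\eta_0(\beta,\gamma)$ is the completion of $\mathcal G(\eta,\eta)$ in $\mathcal G(\beta,\gamma)$, and $(\mathcal G^\eta_0(\beta,\gamma))'$ is its dual. For $f$ in this dual, $Q_k(f)(x)=Q_kf(x):=\langle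 f,Q_k(x,\cdot)\rangle$. "$f\in(\mathcal G^\eta_0(\widetilde\beta,\widetilde\gamma))'$" means that the restriction of $f$ to $\mathcal G(\eta,\eta)$ extends (uniquely, by density) to a continuous linear functional on $\mathcal G^\eta_0(\widetilde\beta,\widetilde\gamma)$; $\|f\|_{(\mathcal G^\eta_0(\widetilde\beta,\widetilde\gamma))'}$ is its functional norm. The integer $N$. With an exp-IATI $\{Q_k\}$ one associates a fixed $N\in\mathbb N$ for which the following (known) reproducing formula holds: for $\beta,\gamma\in(0,\eta)$ and arbitrary points $y^{k,m}_\alpha\in Q^{k,m}_\alpha$ there are bounded linear integral operators $\{\widetilde Q_k\}_{k\in\mathbb Z_+}$ on $L^2(\mathcal X)$ with, for all $f\in(\mathcal G^\eta_0(\beta,\gamma))'$, $$f=\sum_{\alpha\in\mathcal A_0}\sum_m\int_{Q^{0,m}_\alpha}\widetilde Q_0(\cdot,y)\,d\mu(y)\,Q^{0,m}_{\alpha,1}(f)+\sum_{k=1}^N\sum_{\alpha,m}\mu(Q^{k,m}_\alpha)\widetilde Q_k(\cdot,y^{k,m}_\alpha)Q^{k,m}_{\alpha,1}(f)+\sum_{k=N+1}^\infty\sum_{\alpha,m}\mu(Q^{k,m}_\alpha)\widetilde Q_k(\cdot,y^{k,m}_\alpha)Q_kf(y^{k,m}_\alpha)$$ in $(\mathcal G^\eta_0(\beta,\gamma))'$, where $Q^{k,m}_{\alpha,1}(f):=m_{Q^{k,m}_\alpha}(Q_kf)$ and, with $R_k(x,y):=\frac{1}{V_{\delta^k}(x)+V(x,y)}[\frac{\delta^k}{\delta^k+d(x,y)}]^\gamma$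 and $C$ independent of the points $y^{k,m}_\alpha$: $|\widetilde Q_k(x,y)|\le CR_k(x,y)$; $|\widetilde Q_k(x,y)-\widetilde Q_k(x',y)|\le C[\frac{d(x,x')}{\delta^k+d(x,y)}]^\beta R_k(x,y)$ if $d(x,x')\le(2A_0)^{-1}[\delta^k+d(x,y)]$; $\int\widetilde Q_k(x,y)\,d\mu(y)=\int\widetilde Q_k(y,x)\,d\mu(y)$ equals $1$ if $k\le N$ and $0$ if $k>N$. Index and space. For $|s|<t$, $p(s,t):=\max\{\frac{\omega}{\omega+t},\frac{\omega}{\omega+t+s}\}$. Fix an exp-IATI $\{Q_k\}_{k\in\mathbb Z_+}$ and its $N$. $F^s_{\infty,q}(\mathcal X)$ is the set of $f\in(\mathcal G^\eta_0(\beta,\gamma))'$ for which the following quantity $\|f\|_{F^s_{\infty,q}(\mathcal X)}$ is finite: the maximum of $\sup_{0\le k\le N}\sup_{\alpha\in\mathcal A_k}\sup_{1\le m\le N(k,\alpha)}m_{Q^{k,m}_\alpha}(|Q_k(f)|)$ and $\sup_{l\in\mathbb N,\,l>N}\sup_{\alpha\in\mathcal A_l}\{\frac1{\mu(Q^l_\alpha)}\int_{Q^l_\alpha}\sum_{k=l}^\infty\delta^{-ksq}|Q_k(f)(x)|^q\,d\mu(x)\}^{1/q}$ (usual modification for $q=\infty$). *)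

theory Defs
  imports "HOL-Analysis.Analysis" "HOL-Probability.Essential_Supremum"
begin

section \<open>Spaces of homogeneous type with a dyadic structure\<close>

text \<open>The underlying set is the whole type \<^typ>\<open>'a\<close>; \<^typ>\<open>'i\<close> is the type of
  the indices \<open>\<alpha>\<close> of the dyadic points and cubes.\<close>

record ('a, 'i) hspace =
  qdist :: "'a \<Rightarrow> 'a \<Rightarrow> real"            \<comment> \<open>\<open>d\<close>\<close>
  qconst :: real                        \<comment> \<open>\<open>A\<^sub>0\<close>\<close>
  qmeas :: "'a measure"                 \<comment> \<open>\<open>\<mu>\<close>\<close>
  dblconst :: real                      \<comment> \<open>\<open>C\<^sub>\<mu>\<close>\<close>
  sepconst :: real                      \<comment> \<open>\<open>c\<^sub>0\<close>\<close>
  covconst :: real                      \<comment> \<open>\<open>C\<^sub>0\<close>\<close>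
  mesh :: real                          \<comment> \<open>\<open>\<delta>\<close>\<close>
  indices :: "int \<Rightarrow> 'i set"            \<comment> \<open>\<open>\<A>\<^sub>k\<close>\<close>
  dpoint :: "int \<Rightarrow> 'i \<Rightarrow> 'a"           \<comment> \<open>\<open>z\<^sup>k\<^sub>\<alpha>\<close>\<close>
  cube :: "int \<Rightarrow> 'i \<Rightarrow> 'a set"         \<comment> \<open>\<open>Q\<^sup>k\<^sub>\<alpha>\<close>\<close>
  subgap :: nat                         \<comment> \<open>\<open>j\<^sub>0\<close>\<close>
  basept :: 'a                          \<comment> \<open>\<open>x\<^sub>0\<close>\<close>

definition qball :: "('a, 'i) hspace \<Rightarrow> 'a \<Rightarrow> real \<Rightarrow> 'a set" where
  "qball S x r = {y. qdist S x y < r}"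

definition quasi_metric :: "('a, 'i) hspace \<Rightarrow> bool" where
  "quasi_metric S \<longleftrightarrow>
     1 \<le> qconst S \<and>
     (\<forall>x y. 0 \<le> qdist S x y) \<and>
     (\<forall>x y. qdist S x y = 0 \<longleftrightarrow> x = y) \<and>
     (\<forall>x y. qdist S x y = qdist S y x) \<and>
     (\<forall>x y z. qdist S x z \<le> qconst S * (qdist S x y + qdist S y z))"

definition homogeneous_type :: "('a, 'i) hspace \<Rightarrow> bool" where
  "homogeneous_type S \<longleftrightarrow>
     quasi_metric S \<and>
     space (qmeas S) = UNIV \<and>
     (\<forall>x. \<forall>r>0. qball S x r \<in> sets (qmeas S) \<and>
        0 < emeasure (qmeas S) (qball S x r) \<and> emeasure (qmeas S) (qball S x r) < \<infinity> \<and>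
        emeasure (qmeas S) (qball S x (2 * r))
          \<le> ennreal (dblconst S) * emeasure (qmeas S) (qball S x r))"

definition homdim :: "('a, 'i) hspace \<Rightarrow> real" where
  "homdim S = log 2 (dblconst S)"

definition vol :: "('a, 'i) hspace \<Rightarrow> real \<Rightarrow> 'a \<Rightarrow> real" where
  "vol S r x = measure (qmeas S) (qball S x r)"

definition volxy :: "('a, 'i) hspace \<Rightarrow> 'a \<Rightarrow> 'a \<Rightarrow> real" where
  "volxy S x y = vol S (qdist S x y) x"

definition dyadic_points :: "('a, 'i) hspace \<Rightarrow> bool" where
  "dyadic_points S \<longleftrightarrow>
     0 < sepconst S \<and> sepconst S \<le> covconst S \<and>
     0 < mesh S \<and> mesh S < 1 \<and>
     12 * qconst S ^ 3 * covconst S * mesh S \<le> sepconst S \<and>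
     (\<forall>k. indices S k \<subseteq> indices S (k + 1)) \<and>
     (\<forall>k. \<forall>\<alpha>\<in>indices S k. dpoint S (k + 1) \<alpha> = dpoint S k \<alpha>) \<and>
     (\<forall>k. \<forall>\<alpha>\<in>indices S k. \<forall>\<beta>\<in>indices S k. \<alpha> \<noteq> \<beta> \<longrightarrow>
        sepconst S * mesh S powi k \<le> qdist S (dpoint S k \<alpha>) (dpoint S k \<beta>)) \<and>
     (\<forall>k x. \<exists>\<alpha>\<in>indices S k. qdist S x (dpoint S k \<alpha>) < covconst S * mesh S powi k)"

text \<open>The sets \<open>\<Y>\<^sup>k\<close> of points that are new at level \<open>k + 1\<close>.\<close>

definition newpts :: "('a, 'i) hspace \<Rightarrow> int \<Rightarrow> 'a set" where
  "newpts S k = dpoint S (k + 1) ` (indices S (k + 1) - indices S k)"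

definition dyadic_cubes :: "('a, 'i) hspace \<Rightarrow> bool" where
  "dyadic_cubes S \<longleftrightarrow>
     (\<forall>k. \<forall>\<alpha>\<in>indices S k. cube S k \<alpha> \<in> sets (qmeas S)) \<and>
     (\<forall>k. disjoint_family_on (cube S k) (indices S k)) \<and>
     (\<forall>k. (\<Union>\<alpha>\<in>indices S k. cube S k \<alpha>) = UNIV) \<and>
     (\<forall>k l. k \<le> l \<longrightarrow> (\<forall>\<alpha>\<in>indices S k. \<forall>\<beta>\<in>indices S l.
        cube S l \<beta> \<subseteq> cube S k \<alpha> \<or> cube S l \<beta> \<inter> cube S k \<alpha> = {})) \<and>
     (\<forall>k. \<forall>\<alpha>\<in>indices S k.
        qball S (dpoint S k \<alpha>) (sepconst S * mesh S powi k / (3 * (qconst S)\<^sup>2)) \<subseteq> cube S k \<alpha> \<and>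
        cube S k \<alpha> \<subseteq> qball S (dpoint S k \<alpha>) (2 * qconst S * covconst S * mesh S powi k)) \<and>
     1 \<le> subgap S \<and>
     mesh S ^ subgap S \<le> covconst S / (2 * qconst S) ^ 3"

text \<open>The subcubes \<open>Q\<^sup>k\<^sup>,\<^sup>m\<^sub>\<alpha>\<close>, \<open>m = 1, \<dots>, N(k,\<alpha>)\<close>, are labelled not by \<open>m\<close> but
  by the index \<open>\<tau>\<close> at level \<open>k + j\<^sub>0\<close> of the cube that \<open>m\<close> enumerates.\<close>

definition subidx :: "('a, 'i) hspace \<Rightarrow> nat \<Rightarrow> 'i \<Rightarrow> 'i set" where
  "subidx S k \<alpha> = {\<tau> \<in> indices S (int (k + subgap S)).
                     cube S (int (k + subgap S)) \<tau> \<subseteq> cube S (int k) \<alpha>}"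

definition subcube :: "('a, 'i) hspace \<Rightarrow> nat \<Rightarrow> 'i \<Rightarrow> 'a set" where
  "subcube S k \<tau> = cube S (int (k + subgap S)) \<tau>"


section \<open>Approximations of the identity\<close>

definition L2_fun :: "('a, 'i) hspace \<Rightarrow> ('a \<Rightarrow> complex) set" where
  "L2_fun S = {f \<in> borel_measurable (qmeas S). integrable (qmeas S) (\<lambda>x. (cmod (f x))\<^sup>2)}"

definition L2_nrm :: "('a, 'i) hspace \<Rightarrow> ('a \<Rightarrow> complex) \<Rightarrow> real" where
  "L2_nrm S f = sqrt (\<integral>x. (cmod (f x))\<^sup>2 \<partial>qmeas S)"

definition int_op :: "('a, 'i) hspace \<Rightarrow> ('a \<Rightarrow> 'a \<Rightarrow> complex) \<Rightarrow> ('a \<Rightarrow> complex) \<Rightarrow> 'a \<Rightarrow> complex" where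
  "int_op S K f x = (\<integral>y. K x y * f y \<partial>qmeas S)"

definition L2_int_op :: "('a, 'i) hspace \<Rightarrow> ('a \<Rightarrow> 'a \<Rightarrow> complex) \<Rightarrow> bool" where
  "L2_int_op S K \<longleftrightarrow>
     (\<lambda>(x, y). K x y) \<in> borel_measurable (qmeas S \<Otimes>\<^sub>M qmeas S) \<and>
     (\<forall>f\<in>L2_fun S. AE x in qmeas S. integrable (qmeas S) (\<lambda>y. K x y * f y)) \<and>
     (\<forall>f\<in>L2_fun S. int_op S K f \<in> L2_fun S) \<and>
     (\<exists>C. \<forall>f\<in>L2_fun S. L2_nrm S (int_op S K f) \<le> C * L2_nrm S f)"

definition exp_bound0 :: "('a, 'i) hspace \<Rightarrow> real \<Rightarrow> real \<Rightarrow> nat \<Rightarrow> 'a \<Rightarrow> 'a \<Rightarrow> real" where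
  "exp_bound0 S \<nu> a k x y =
     1 / sqrt (vol S (mesh S ^ k) x * vol S (mesh S ^ k) y)
     * exp (- \<nu> * (qdist S x y / mesh S ^ k) powr a)"

text \<open>The second exponential factor of \<open>E\<^sub>k\<close>. Since the infimum of the empty set is \<open>\<infinity>\<close>, the
  factor is \<open>0\<close> if \<open>\<Y>\<^sup>k\<close> is empty; this case is separated because \<^const>\<open>Inf\<close> on reals does not
  follow that convention.\<close>

definition newpts_decay :: "('a, 'i) hspace \<Rightarrow> real \<Rightarrow> real \<Rightarrow> nat \<Rightarrow> 'a \<Rightarrow> 'a \<Rightarrow> real" where
  "newpts_decay S \<nu> a k x y =
     (let Y = newpts S (int k); dY = (\<lambda>u. INF v\<in>Y. qdist S u v)
      in if Y = {} then 0 else exp (- \<nu> * (max (dY x) (dY y) / mesh S ^ k) powr a))"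

definition exp_bound :: "('a, 'i) hspace \<Rightarrow> real \<Rightarrow> real \<Rightarrow> nat \<Rightarrow> 'a \<Rightarrow> 'a \<Rightarrow> real" where
  "exp_bound S \<nu> a k x y = exp_bound0 S \<nu> a k x y * newpts_decay S \<nu> a k x y"

text \<open>Size and regularity conditions (a), (b), (c) at scale \<open>r\<close> for a kernel \<open>K\<close> with majorant
  \<open>E\<close>.\<close>

definition kernel_est ::
  "('a, 'i) hspace \<Rightarrow> real \<Rightarrow> real \<Rightarrow> real \<Rightarrow> ('a \<Rightarrow> 'a \<Rightarrow> real) \<Rightarrow> ('a \<Rightarrow> 'a \<Rightarrow> complex) \<Rightarrow> bool" where
  "kernel_est S \<eta> C r E K \<longleftrightarrow>
     (\<forall>x y. cmod (K x y) \<le> C * E x y) \<and>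
     (\<forall>x x' y. qdist S x x' \<le> r \<longrightarrow>
        cmod (K x y - K x' y) + cmod (K y x - K y x') \<le> C * (qdist S x x' / r) powr \<eta> * E x y) \<and>
     (\<forall>x x' y y'. qdist S x x' \<le> r \<longrightarrow> qdist S y y' \<le> r \<longrightarrow>
        cmod ((K x y - K x' y) - (K x y' - K x' y'))
          \<le> C * (qdist S x x' / r) powr \<eta> * (qdist S y y' / r) powr \<eta> * E x y)"

text \<open>Both marginal integrals of a kernel are identically \<open>c\<close>.\<close>

definition marginals :: "('a, 'i) hspace \<Rightarrow> ('a \<Rightarrow> 'a \<Rightarrow> complex) \<Rightarrow> complex \<Rightarrow> bool" where
  "marginals S K c \<longleftrightarrow>
     (\<forall>x. integrable (qmeas S) (\<lambda>y. K x y) \<and> (\<integral>y. K x y \<partial>qmeas S) = c) \<and>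
     (\<forall>x. integrable (qmeas S) (\<lambda>y. K y x) \<and> (\<integral>y. K y x \<partial>qmeas S) = c)"

definition exp_IATI :: "('a, 'i) hspace \<Rightarrow> real \<Rightarrow> (nat \<Rightarrow> 'a \<Rightarrow> 'a \<Rightarrow> complex) \<Rightarrow> bool" where
  "exp_IATI S \<eta> Q \<longleftrightarrow>
     (\<forall>k. L2_int_op S (Q k)) \<and>
     (\<forall>f\<in>L2_fun S. (\<lambda>n. L2_nrm S (\<lambda>x. (\<Sum>k\<le>n. int_op S (Q k) f x) - f x)) \<longlonglongrightarrow> 0) \<and>
     (\<exists>C \<nu> a. 0 < C \<and> 0 < \<nu> \<and> 0 < a \<and> a \<le> 1 \<and>
        kernel_est S \<eta> C 1 (exp_bound0 S \<nu> a 0) (Q 0) \<and>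
        (\<forall>k\<ge>1. kernel_est S \<eta> C (mesh S ^ k) (exp_bound S \<nu> a k) (Q k))) \<and>
     marginals S (Q 0) 1 \<and>
     (\<forall>k\<ge>1. marginals S (Q k) 0)"


section \<open>Test functions and distributions\<close>

definition test_decay :: "('a, 'i) hspace \<Rightarrow> real \<Rightarrow> 'a \<Rightarrow> real" where
  "test_decay S \<gamma> x =
     1 / (vol S 1 (basept S) + volxy S (basept S) x) * (1 + qdist S (basept S) x) powr (- \<gamma>)"

definition test_bound :: "('a, 'i) hspace \<Rightarrow> real \<Rightarrow> real \<Rightarrow> ('a \<Rightarrow> complex) \<Rightarrow> real \<Rightarrow> bool" where
  "test_bound S \<beta> \<gamma> f C \<longleftrightarrow>
     0 < C \<and>
     (\<forall>x. cmod (f x) \<le> C * test_decay S \<gamma> x) \<and>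
     (\<forall>x y. qdist S x y \<le> (1 + qdist S (basept S) x) / (2 * qconst S) \<longrightarrow>
        cmod (f x - f y)
          \<le> C * (qdist S x y / (1 + qdist S (basept S) x)) powr \<beta> * test_decay S \<gamma> x)"

definition test_space :: "('a, 'i) hspace \<Rightarrow> real \<Rightarrow> real \<Rightarrow> ('a \<Rightarrow> complex) set" where
  "test_space S \<beta> \<gamma> = {f. \<exists>C. test_bound S \<beta> \<gamma> f C}"

definition test_norm :: "('a, 'i) hspace \<Rightarrow> real \<Rightarrow> real \<Rightarrow> ('a \<Rightarrow> complex) \<Rightarrow> real" where
  "test_norm S \<beta> \<gamma> f = Inf {C. test_bound S \<beta> \<gamma> f C}"

text \<open>The completion of \<open>\<G>(\<eta>,\<eta>)\<close> inside the Banach space \<open>\<G>(\<beta>,\<gamma>)\<close>, that is, its closure.\<close>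

definition test_space0 :: "('a, 'i) hspace \<Rightarrow> real \<Rightarrow> real \<Rightarrow> real \<Rightarrow> ('a \<Rightarrow> complex) set" where
  "test_space0 S \<eta> \<beta> \<gamma> =
     {f \<in> test_space S \<beta> \<gamma>.
        \<forall>\<epsilon>>0. \<exists>g\<in>test_space S \<eta> \<eta>. test_norm S \<beta> \<gamma> (\<lambda>x. f x - g x) < \<epsilon>}"

text \<open>Functionals are \<^const>\<open>extensional\<close>, so that a functional is determined by its values on
  its domain.\<close>

definition dual :: "('a, 'i) hspace \<Rightarrow> real \<Rightarrow> real \<Rightarrow> real \<Rightarrow> (('a \<Rightarrow> complex) \<Rightarrow> complex) set" where
  "dual S \<eta> \<beta> \<gamma> =
     {f \<in> extensional (test_space0 S \<eta> \<beta> \<gamma>).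
        (\<forall>\<phi>\<in>test_space0 S \<eta> \<beta> \<gamma>. \<forall>\<psi>\<in>test_space0 S \<eta> \<beta> \<gamma>. \<forall>a b.
           f (\<lambda>x. a * \<phi> x + b * \<psi> x) = a * f \<phi> + b * f \<psi>) \<and>
        (\<exists>C. \<forall>\<phi>\<in>test_space0 S \<eta> \<beta> \<gamma>. cmod (f \<phi>) \<le> C * test_norm S \<beta> \<gamma> \<phi>)}"

definition dual_norm ::
  "('a, 'i) hspace \<Rightarrow> real \<Rightarrow> real \<Rightarrow> real \<Rightarrow> (('a \<Rightarrow> complex) \<Rightarrow> complex) \<Rightarrow> real" where
  "dual_norm S \<eta> \<beta> \<gamma> f =
     Sup {cmod (f \<phi>) |\<phi>. \<phi> \<in> test_space0 S \<eta> \<beta> \<gamma> \<and> test_norm S \<beta> \<gamma> \<phi> \<le> 1}"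

text \<open>\<open>g\<close> is an element of the dual of \<open>\<G>\<^sup>\<eta>\<^sub>0(\<beta>,\<gamma>)\<close> that coincides with \<open>f\<close> on
  \<open>\<G>(\<eta>,\<eta>)\<close>.\<close>

definition dual_extension ::
  "('a, 'i) hspace \<Rightarrow> real \<Rightarrow> real \<Rightarrow> real \<Rightarrow> (('a \<Rightarrow> complex) \<Rightarrow> complex)
    \<Rightarrow> (('a \<Rightarrow> complex) \<Rightarrow> complex) \<Rightarrow> bool" where
  "dual_extension S \<eta> \<beta> \<gamma> f g \<longleftrightarrow>
     g \<in> dual S \<eta> \<beta> \<gamma> \<and> (\<forall>\<phi>\<in>test_space S \<eta> \<eta>. g \<phi> = f \<phi>)"


section \<open>The discrete reproducing formula\<close>

definition Qf :: "(nat \<Rightarrow> 'a \<Rightarrow> 'a \<Rightarrow> complex) \<Rightarrow> (('a \<Rightarrow> complex) \<Rightarrow> complex) \<Rightarrow> nat \<Rightarrow> 'a \<Rightarrow> complex" where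
  "Qf Q f k x = f (\<lambda>y. Q k x y)"

definition mean :: "('a, 'i) hspace \<Rightarrow> 'a set \<Rightarrow> ('a \<Rightarrow> complex) \<Rightarrow> complex" where
  "mean S E g = (LINT x:E|qmeas S. g x) / of_real (measure (qmeas S) E)"

definition poly_bound :: "('a, 'i) hspace \<Rightarrow> real \<Rightarrow> nat \<Rightarrow> 'a \<Rightarrow> 'a \<Rightarrow> real" where
  "poly_bound S \<gamma> k x y =
     1 / (vol S (mesh S ^ k) x + volxy S x y)
     * (mesh S ^ k / (mesh S ^ k + qdist S x y)) powr \<gamma>"

text \<open>The term of index \<open>(k, \<alpha>, \<tau>)\<close> of the reproducing formula, paired with the test function
  \<open>\<phi>\<close>; \<open>y k \<alpha> \<tau>\<close> is the sample point and \<open>Qt k\<close> the kernel of the dual operator.\<close>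

definition repr_term ::
  "('a, 'i) hspace \<Rightarrow> (nat \<Rightarrow> 'a \<Rightarrow> 'a \<Rightarrow> complex) \<Rightarrow> nat \<Rightarrow> (nat \<Rightarrow> 'i \<Rightarrow> 'i \<Rightarrow> 'a)
    \<Rightarrow> (nat \<Rightarrow> 'a \<Rightarrow> 'a \<Rightarrow> complex) \<Rightarrow> (('a \<Rightarrow> complex) \<Rightarrow> complex) \<Rightarrow> ('a \<Rightarrow> complex)
    \<Rightarrow> nat \<Rightarrow> 'i \<Rightarrow> 'i \<Rightarrow> complex" where
  "repr_term S Q N y Qt f \<phi> k \<alpha> \<tau> =
     (if k = 0 then
        (\<integral>x. (LINT u:subcube S 0 \<tau>|qmeas S. Qt 0 x u) * \<phi> x \<partial>qmeas S)
          * mean S (subcube S 0 \<tau>) (Qf Q f 0)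
      else
        of_real (measure (qmeas S) (subcube S k \<tau>))
          * (\<integral>x. Qt k x (y k \<alpha> \<tau>) * \<phi> x \<partial>qmeas S)
          * (if k \<le> N then mean S (subcube S k \<tau>) (Qf Q f k) else Qf Q f k (y k \<alpha> \<tau>)))"

text \<open>The property by which \<open>N\<close> is associated with an exp-IATI. The formula is understood in the
  weak-* sense: for each test function the series over \<open>(\<alpha>, \<tau>)\<close>, whose index set is
  unordered, converges unconditionally for every \<open>k\<close>, and the series over \<open>k\<close> of the results
  converges. The constant \<open>C\<close> may depend on \<open>\<beta>, \<gamma>\<close> but not on the sample points.\<close>

definition reproducing ::
  "('a, 'i) hspace \<Rightarrow> real \<Rightarrow> (nat \<Rightarrow> 'a \<Rightarrow> 'a \<Rightarrow> complex) \<Rightarrow> nat \<Rightarrow> bool" where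
  "reproducing S \<eta> Q N \<longleftrightarrow>
     1 \<le> N \<and>
     (\<forall>\<beta> \<gamma>. 0 < \<beta> \<longrightarrow> \<beta> < \<eta> \<longrightarrow> 0 < \<gamma> \<longrightarrow> \<gamma> < \<eta> \<longrightarrow>
       (\<exists>C>0. \<forall>y.
          (\<forall>k. \<forall>\<alpha>\<in>indices S (int k). \<forall>\<tau>\<in>subidx S k \<alpha>. y k \<alpha> \<tau> \<in> subcube S k \<tau>) \<longrightarrow>
          (\<exists>Qt.
             (\<forall>k. L2_int_op S (Qt k)) \<and>
             (\<forall>k u v. cmod (Qt k u v) \<le> C * poly_bound S \<gamma> k u v) \<and>
             (\<forall>k u u' v. qdist S u u' \<le> (mesh S ^ k + qdist S u v) / (2 * qconst S) \<longrightarrow>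
                cmod (Qt k u v - Qt k u' v)
                  \<le> C * (qdist S u u' / (mesh S ^ k + qdist S u v)) powr \<beta>
                      * poly_bound S \<gamma> k u v) \<and>
             (\<forall>k. marginals S (Qt k) (if k \<le> N then 1 else 0)) \<and>
             (\<forall>f\<in>dual S \<eta> \<beta> \<gamma>. \<forall>\<phi>\<in>test_space0 S \<eta> \<beta> \<gamma>.
                \<exists>t. (\<forall>k. ((\<lambda>(\<alpha>, \<tau>). repr_term S Q N y Qt f \<phi> k \<alpha> \<tau>) has_sum t k)
                          (SIGMA \<alpha>:indices S (int k). subidx S k \<alpha>)) \<and>
                    t sums f \<phi>))))"


section \<open>The Triebel--Lizorkin spaces with integrability index infinity\<close>

definition crit_index :: "('a, 'i) hspace \<Rightarrow> real \<Rightarrow> real \<Rightarrow> real" where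
  "crit_index S s t = max (homdim S / (homdim S + t)) (homdim S / (homdim S + t + s))"

definition enn_powr :: "ennreal \<Rightarrow> real \<Rightarrow> ennreal" where
  "enn_powr u r = (if u = \<infinity> then \<infinity> else ennreal (enn2real u powr r))"

text \<open>The quantity attached to the cube \<open>Q\<^sup>l\<^sub>\<alpha>\<close>. For \<open>q = \<infinity>\<close> the normalised \<open>L\<^sup>q\<close> norm
  and the \<open>\<ell>\<^sup>q\<close> norm are replaced by the essential supremum and the supremum.\<close>

definition F_local ::
  "('a, 'i) hspace \<Rightarrow> (nat \<Rightarrow> 'a \<Rightarrow> 'a \<Rightarrow> complex) \<Rightarrow> real \<Rightarrow> ennreal
    \<Rightarrow> (('a \<Rightarrow> complex) \<Rightarrow> complex) \<Rightarrow> nat \<Rightarrow> 'i \<Rightarrow> ennreal" where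
  "F_local S Q s q f l \<alpha> =
     (if q = \<infinity> then
        esssup (restrict_space (qmeas S) (cube S (int l) \<alpha>))
          (\<lambda>x. SUP k\<in>{l..}. ennreal (mesh S powr (- (real k * s)) * cmod (Qf Q f k x)))
      else
        enn_powr
          ((\<integral>\<^sup>+x\<in>cube S (int l) \<alpha>.
              (\<Sum>i. ennreal (mesh S powr (- (real (l + i) * s * enn2real q))
                             * cmod (Qf Q f (l + i) x) powr enn2real q)) \<partial>qmeas S)
            / emeasure (qmeas S) (cube S (int l) \<alpha>))
          (1 / enn2real q))"

definition F_norm ::
  "('a, 'i) hspace \<Rightarrow> (nat \<Rightarrow> 'a \<Rightarrow> 'a \<Rightarrow> complex) \<Rightarrow> nat \<Rightarrow> real \<Rightarrow> ennreal
    \<Rightarrow> (('a \<Rightarrow> complex) \<Rightarrow> complex) \<Rightarrow> ennreal" where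
  "F_norm S Q N s q f =
     max
       (SUP k\<in>{..N}. SUP \<alpha>\<in>indices S (int k). SUP \<tau>\<in>subidx S k \<alpha>.
          (\<integral>\<^sup>+x\<in>subcube S k \<tau>. ennreal (cmod (Qf Q f k x)) \<partial>qmeas S)
            / emeasure (qmeas S) (subcube S k \<tau>))
       (SUP l\<in>{N<..}. SUP \<alpha>\<in>indices S (int l). F_local S Q s q f l \<alpha>)"

definition F_space ::
  "('a, 'i) hspace \<Rightarrow> real \<Rightarrow> real \<Rightarrow> real \<Rightarrow> (nat \<Rightarrow> 'a \<Rightarrow> 'a \<Rightarrow> complex) \<Rightarrow> nat \<Rightarrow> real \<Rightarrow> ennreal
    \<Rightarrow> (('a \<Rightarrow> complex) \<Rightarrow> complex) set" where
  "F_space S \<eta> \<beta> \<gamma> Q N s q = {f \<in> dual S \<eta> \<beta> \<gamma>. F_norm S Q N s q f < \<infinity>}"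

end

(* Pair f with a test function phi and insert the discrete reproducing formula in the parameters
   (beta, gamma) of the space in which f lives; the exponents beta', gamma' only enter through phi.

   Choosing the sample points y depending on f makes |Q_k f(y)| at most a multiple of
   delta^(k s) times the norm of f, for every k > N and every q > 0: by Chebyshev's inequality in
   the cube of level k this holds at some point of each subcube.

   Fix b with max(-s, 0) < b < min(beta', gamma). Everywhere |phi(x) - phi(y)| is bounded by a
   multiple of d(x,y)^b (D(x) + D(y)), with D the decay of the test functions of exponent gamma'.
   With the cancellation of the dual kernels this gives a factor delta^(k b) at level k, at the
   price of lowering their decay exponent to gamma - b > 0. Since D is integrable and the kernels
   are integrable in both variables, summing over the subcubes costs a constant, and what remains
   is a geometric series of ratio delta^(b + s) < 1. The resulting estimate on the dense subspace
   G(eta, eta) extends f.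

   Test functions and the functions Q_k f are not known to be measurable. This does no harm:
   upper estimates of nonnegative integrals need measurability only of the majorants, and a
   Bochner integral of a function that is not integrable is 0. *)

theory Submission
  imports Defs
begin

section \<open>Integrals and extended nonnegative reals\<close>

text \<open>The norm of f bounds averages of \<open>Qf Q f k\<close> over cubes, not its values at
  prescribed points. Adapting the sample points to f is legitimate because in
  \<open>reproducing\<close> the constant of the dual kernels is fixed before the points are, so the
  final constant stays uniform in f. f is known only on the first space of test functions, so its
  expansion can be paired only with elements of that space. G(eta, eta) lies in both spaces: there f
  is evaluated through the first one and phi is measured in the norm of the second. The conditions
  on b are the prices of its uses: b <= beta' is the smoothness that phi offers, b < gamma leaves
  the dual kernels integrable, b > -s gives convergence over the levels. The levels k <= N have no
  cancellation, but they are finitely many and only enlarge the constant.\<close>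

lemma norm_lebesgue_integral_le:
  fixes f :: "'a \<Rightarrow> 'b::{banach, second_countable_topology}"
  shows "ennreal (norm (integral\<^sup>L M f)) \<le> (\<integral>\<^sup>+x. ennreal (norm (f x)) \<partial>M)"
  using integral_norm_bound_ennreal[of M f]
  by (cases "integrable M f") (simp_all add: not_integrable_integral_eq)

lemma norm_set_lebesgue_integral_le:
  fixes f :: "'a \<Rightarrow> 'b::{banach, second_countable_topology}"
  shows "ennreal (norm (LINT x:E|M. f x)) \<le> (\<integral>\<^sup>+x\<in>E. ennreal (norm (f x)) \<partial>M)"
  unfolding set_lebesgue_integral_def
  by (rule order_trans[OF norm_lebesgue_integral_le])
    (auto intro!: nn_integral_mono simp: indicator_def)

lemma ennreal_divide_leD:
  fixes x c m :: ennreal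
  assumes "x / m \<le> c" "0 < m" "m \<noteq> \<infinity>"
  shows "x \<le> c * m"
proof -
  have "m \<noteq> 0" using assms(2) by auto
  then have "m / m = 1" using assms(3) by (intro ennreal_divide_self) (auto simp: less_top)
  then have "x = x * (m / m)" by simp
  also have "\<dots> = x / m * m" by (rule ennreal_divide_times[symmetric])
  also have "\<dots> \<le> c * m" using assms(1) by (rule mult_right_mono) simp
  finally show ?thesis .
qed

text \<open>Undoes the outer exponent 1/q in \<open>F_local\<close>. A finite bound excludes an
  infinite argument, since \<open>enn_powr\<close> keeps infinity.\<close>

lemma enn_powr_leD:
  assumes "enn_powr X (1 / p) \<le> ennreal M" "0 < p" "0 < M"
  shows "X \<le> ennreal (M powr p)"
proof -
  have X: "X \<noteq> \<infinity>" using assms by (auto simp: enn_powr_def top_unique)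
  then have "enn2real X powr (1 / p) \<le> M"
    using assms by (simp add: enn_powr_def)
  then have "(enn2real X powr (1 / p)) powr p \<le> M powr p"
    using assms by (intro powr_mono2) auto
  then have "enn2real X \<le> M powr p" using assms by (simp add: powr_powr)
  then show ?thesis using X
    by (metis ennreal_enn2real ennreal_leI infinity_ennreal_def less_top)
qed

text \<open>In the applications \<open>I\<close> comes from a pairing, \<open>z\<close> is a
  coefficient of f and \<open>J\<close> is the quantity still to be summed. The constant
  \<open>B\<close> varies with the kind of term, whereas \<open>W\<close> is shared by all terms of
  a level.\<close>

lemma ennreal_mult_bound:
  assumes "ennreal I \<le> ennreal B * J" "0 \<le> I" "0 \<le> B" "0 \<le> z" "z \<le> Z" "B * Z \<le> W"
  shows "ennreal (I * z) \<le> ennreal W * J"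
proof -
  have "ennreal (I * z) = ennreal I * ennreal z" using assms by (simp add: ennreal_mult)
  also have "\<dots> \<le> (ennreal B * J) * ennreal Z"
    using assms by (intro mult_mono ennreal_leI) auto
  also have "\<dots> = ennreal (B * Z) * J"
    using assms by (simp add: ennreal_mult mult_ac)
  also have "\<dots> \<le> ennreal W * J" using assms by (intro mult_right_mono ennreal_leI) auto
  finally show ?thesis .
qed

text \<open>Norms given by infima and approximation in a dense subspace both leave an error; each
  such error is sent to 0 in this form.\<close>

lemma le_of_forall_pos_le_mult:
  fixes x y :: real
  assumes "\<And>e. 0 < e \<Longrightarrow> x \<le> y + c * e" "0 \<le> c"
  shows "x \<le> y"
proof (rule field_le_epsilon)
  fix e :: real assume e: "0 < e"
  \<comment> \<open>\<open>c\<close> may be 0, so the error is divided by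
    \<open>c + 1\<close>.\<close>
  have "x \<le> y + c * (e / (c + 1))" using assms(2) e by (intro assms(1) divide_pos_pos) auto
  also have "c * (e / (c + 1)) \<le> e" using assms(2) e by (simp add: divide_simps)
  finally show "x \<le> y + e" by simp
qed

section \<open>Volume growth and polynomial kernels\<close>

locale doubling_space =
  fixes S :: "('a, 'i) hspace"
  assumes homogeneous: "homogeneous_type S"
begin

abbreviation d where "d \<equiv> qdist S"
abbreviation A where "A \<equiv> qconst S"
abbreviation \<mu> where "\<mu> \<equiv> qmeas S"

lemma
  shows A_ge_1: "1 \<le> A"
    and d_nonneg [simp]: "0 \<le> d x y"
    and d_eq_0: "d x y = 0 \<longleftrightarrow> x = y"
    and d_commute: "d x y = d y x"
    and d_triangle: "d x z \<le> A * (d x y + d y z)"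
    and space_eq_UNIV [simp]: "space \<mu> = UNIV"
proof -
  have q: "quasi_metric S" and "space \<mu> = UNIV"
    using homogeneous by (simp_all add: homogeneous_type_def)
  then show "space \<mu> = UNIV" by simp
  show "1 \<le> A" "0 \<le> d x y" "d x y = 0 \<longleftrightarrow> x = y"
    using q by (simp_all add: quasi_metric_def)
  have "\<forall>x y. d x y = d y x"
    using q unfolding quasi_metric_def by (elim conjE)
  then show "d x y = d y x" by blast
  have "\<forall>x y z. d x z \<le> A * (d x y + d y z)"
    using q unfolding quasi_metric_def by (elim conjE)
  then show "d x z \<le> A * (d x y + d y z)" by blast
qed

section \<open>Volumes of balls and their growth\<close>

lemma
  assumes "0 < r"
  shows qball_sets_pos: "qball S x r \<in> sets \<mu>"
    and emeasure_qball_pos: "0 < emeasure \<mu> (qball S x r)"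
    and emeasure_qball_finite: "emeasure \<mu> (qball S x r) < \<infinity>"
    and emeasure_qball_double:
      "emeasure \<mu> (qball S x (2 * r)) \<le> ennreal (dblconst S) * emeasure \<mu> (qball S x r)"
  using homogeneous assms unfolding homogeneous_type_def by simp_all

lemma qball_sets [measurable]: "qball S x r \<in> sets \<mu>"
proof (cases "0 < r")
  case False
  then have "qball S x r = {}"
    using d_nonneg[of x] by (auto simp: qball_def not_less intro: order_trans)
  then show ?thesis by simp
qed (rule qball_sets_pos)

lemma qball_mono: "r \<le> t \<Longrightarrow> qball S x r \<subseteq> qball S x t"
  by (auto simp: qball_def)

lemma qball_subset:
  assumes "d x y \<le> t" "A * (t + r) \<le> R"
  shows "qball S y r \<subseteq> qball S x R"
proof
  fix z assume "z \<in> qball S y r"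
  then have "d y z < r" by (simp add: qball_def)
  then have "A * (d x y + d y z) < A * (t + r)"
    using assms(1) A_ge_1 by (intro mult_strict_left_mono) auto
  then show "z \<in> qball S x R"
    using d_triangle[of x z y] assms(2) by (simp add: qball_def)
qed

lemma emeasure_qball_lt_top: "emeasure \<mu> (qball S x r) < \<infinity>"
proof -
  have "emeasure \<mu> (qball S x r) \<le> emeasure \<mu> (qball S x (max r 1))"
    by (intro emeasure_mono qball_mono) auto
  also have "\<dots> < \<infinity>" by (rule emeasure_qball_finite) simp
  finally show ?thesis .
qed

lemma emeasure_qball: "emeasure \<mu> (qball S x r) = ennreal (vol S r x)"
  unfolding vol_def using emeasure_qball_lt_top[of x r] by (intro emeasure_eq_ennreal_measure) auto

lemma vol_nonneg [simp]: "0 \<le> vol S r x"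
  by (simp add: vol_def)

lemma vol_pos: "0 < r \<Longrightarrow> 0 < vol S r x"
  using emeasure_qball_pos[of r x] by (simp add: emeasure_qball)

lemma vol_mono_set: "qball S x r \<subseteq> qball S y t \<Longrightarrow> vol S r x \<le> vol S t y"
  using emeasure_mono[of "qball S x r" "qball S y t" \<mu>] by (simp add: emeasure_qball)

lemma vol_mono: "r \<le> t \<Longrightarrow> vol S r x \<le> vol S t x"
  by (intro vol_mono_set qball_mono)

text \<open>A ball is contained in its double and has positive finite measure, so no factor below 1
  can be admissible.\<close>

lemma dblconst_ge_1: "1 \<le> dblconst S"
proof (rule ccontr)
  assume "\<not> 1 \<le> dblconst S"
  then have less: "dblconst S < 1" by simp
  fix x :: 'a
  have p: "0 < vol S 1 x" by (simp add: vol_pos)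
  have "ennreal (vol S 1 x) \<le> ennreal (vol S (2 * 1) x)" by (intro ennreal_leI vol_mono) simp
  also have "\<dots> \<le> ennreal (dblconst S) * ennreal (vol S 1 x)"
    using emeasure_qball_double[of 1 x] by (simp add: emeasure_qball)
  \<comment> \<open>\<open>ennreal\<close> truncates negative numbers to 0, and the sign of the
    doubling constant is still unknown at this point.\<close>
  also have "\<dots> = ennreal (max 0 (dblconst S) * vol S 1 x)"
    by (simp add: ennreal_mult ennreal_max_0)
  finally have "vol S 1 x \<le> max 0 (dblconst S) * vol S 1 x"
    by (subst (asm) ennreal_le_iff) auto
  also have "\<dots> < 1 * vol S 1 x" using p less by (intro mult_strict_right_mono) auto
  finally show False by simp
qed

lemma vol_double:
  assumes "0 < r"
  shows "vol S (2 * r) x \<le> dblconst S * vol S r x"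
proof -
  have "ennreal (vol S (2 * r) x) \<le> ennreal (dblconst S * vol S r x)"
    using emeasure_qball_double[OF assms, of x] dblconst_ge_1
    by (simp add: emeasure_qball ennreal_mult)
  then show ?thesis using dblconst_ge_1 by (subst (asm) ennreal_le_iff) auto
qed

lemma vol_power:
  assumes "0 < r"
  shows "vol S (2 ^ n * r) x \<le> dblconst S ^ n * vol S r x"
proof (induction n)
  case (Suc n)
  have "vol S (2 * (2 ^ n * r)) x \<le> dblconst S * vol S (2 ^ n * r) x"
    using assms by (intro vol_double) simp
  also have "\<dots> \<le> dblconst S * (dblconst S ^ n * vol S r x)"
    using Suc dblconst_ge_1 by (intro mult_left_mono) auto
  finally show ?case by (simp add: mult.assoc)
qed simp

lemma vol_dilate:
  obtains K where "1 \<le> K" "\<And>r x. 0 < r \<Longrightarrow> vol S (l * r) x \<le> K * vol S r x"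
proof -
  obtain n :: nat where n: "l < 2 ^ n"
    using real_arch_pow[of 2 l] by auto
  show ?thesis
  proof (rule that[of "dblconst S ^ n"])
    show "1 \<le> dblconst S ^ n" using dblconst_ge_1 by (rule one_le_power)
    fix r x assume "0 < (r :: real)"
    then have "vol S (l * r) x \<le> vol S (2 ^ n * r) x" using n by (intro vol_mono) simp
    also have "\<dots> \<le> dblconst S ^ n * vol S r x" by (rule vol_power) fact
    finally show "vol S (l * r) x \<le> dblconst S ^ n * vol S r x" .
  qed
qed

lemma measurable_d [measurable]: "(\<lambda>y. d x y) \<in> borel_measurable \<mu>"
proof (rule borel_measurableI_less)
  fix t :: real
  have "{y \<in> space \<mu>. d x y < t} = qball S x t" by (simp add: qball_def)
  then show "{y \<in> space \<mu>. d x y < t} \<in> sets \<mu>" by simp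
qed

lemma measurable_vol [measurable]: "(\<lambda>r. vol S r x) \<in> borel_measurable borel"
  by (intro borel_measurable_mono monoI vol_mono)

text \<open>Up to constants this is symmetric in \<open>x\<close> and \<open>y\<close>, but only as a function of \<open>y\<close>
  is its measurability clear, since only balls about a fixed centre are involved.\<close>

definition hker :: "real \<Rightarrow> real \<Rightarrow> 'a \<Rightarrow> 'a \<Rightarrow> real" where
  "hker g r x y = (r / (r + d x y)) powr g / vol S (r + d x y) x"

section \<open>Polynomial kernels: comparison, integration and summation\<close>

lemma hker_nonneg [simp]: "0 \<le> hker g r x y"
  by (simp add: hker_def)

lemma hker_measurable [measurable]: "(\<lambda>y. hker g r x y) \<in> borel_measurable \<mu>"
  unfolding hker_def by measurable

lemma plus_d_pos: "0 < r \<Longrightarrow> 0 < r + d x y"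
  by (simp add: add_pos_nonneg)

lemma ratio_pos: "0 < r \<Longrightarrow> 0 < r / (r + d x y)"
  by (intro divide_pos_pos plus_d_pos)

lemma ratio_le_1: "0 < r \<Longrightarrow> r / (r + d x y) \<le> 1"
  using plus_d_pos[of r x y] by simp

lemma hker_antimono:
  assumes "0 < r" "g \<le> g'"
  shows "hker g' r x y \<le> hker g r x y"
  unfolding hker_def using assms ratio_pos[of r x y] ratio_le_1[of r x y]
  by (intro divide_right_mono powr_mono' vol_nonneg) auto

text \<open>As d(x,y) <= r + d(x,y), a factor d(x,y)^b uses up b of the decay exponent and leaves
  the power r^b of the scale. This is where the gain from cancellation comes from.\<close>

lemma hker_mult_powr:
  assumes "0 < r" "0 \<le> b"
  shows "hker g r x y * d x y powr b \<le> r powr b * hker (g - b) r x y"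
proof -
  have p: "0 < r + d x y" using assms by (intro plus_d_pos) simp
  have "hker g r x y * d x y powr b \<le> hker g r x y * (r + d x y) powr b"
    using assms by (intro mult_left_mono powr_mono2 hker_nonneg d_nonneg) auto
  also have "\<dots> = r powr b * hker (g - b) r x y"
  proof -
    have "(r + d x y) powr b = r powr b / (r / (r + d x y)) powr b"
      using assms p by (simp add: powr_divide)
    then show ?thesis by (simp add: hker_def powr_diff mult_ac)
  qed
  finally show ?thesis .
qed

text \<open>The ratio is symmetric already. With t = r + d(x,y), the ball of radius t about
  \<open>y\<close> lies in the one of radius 2 A t about \<open>x\<close>, because d(x,y) <= t;
  doubling absorbs the factor 2 A, with a constant that does not see the exponent.\<close>

lemma hker_commute_le:
  obtains K where "1 \<le> K" "\<And>g r x y. 0 < r \<Longrightarrow> hker g r x y \<le> K * hker g r y x"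
proof -
  obtain K where K: "1 \<le> K" "\<And>r x. 0 < r \<Longrightarrow> vol S (2 * A * r) x \<le> K * vol S r x"
    using vol_dilate[of "2 * A"] by blast
  show ?thesis
  proof (rule that[OF K(1)])
    fix g r x y assume r: "0 < (r :: real)"
    define t where "t = r + d x y"
    have t: "0 < t" using r d_nonneg[of x y] by (simp add: t_def add_pos_nonneg)
    have "vol S t y \<le> vol S (2 * A * t) x"
      using A_ge_1 r by (intro vol_mono_set qball_subset[where t = t]) (auto simp: t_def)
    also have "\<dots> \<le> K * vol S t x" using K(2)[OF t] .
    finally have v: "vol S t y \<le> K * vol S t x" .
    have "1 / vol S t x \<le> K / vol S t y"
      using v vol_pos[OF t] by (simp add: divide_simps)
    then have "(r / t) powr g * (1 / vol S t x) \<le> (r / t) powr g * (K / vol S t y)"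
      by (intro mult_left_mono) auto
    then show "hker g r x y \<le> K * hker g r y x"
      by (simp add: hker_def t_def d_commute[of y x] mult.commute)
  qed
qed

text \<open>Moving the second point by a multiple of the scale changes r + d(x,y) at most by a fixed
  factor. Values at sample points can therefore be compared with values anywhere in a small set
  around them.\<close>

lemma hker_shift:
  assumes "0 \<le> \<kappa>" "0 \<le> g"
  obtains K where "1 \<le> K"
    "\<And>r x y u. 0 < r \<Longrightarrow> d u y \<le> \<kappa> * r \<Longrightarrow> hker g r x y \<le> K * hker g r x u"
proof -
  \<comment> \<open>The quasi-triangle inequality bounds r + d(x,u) by r + A d(x,y) + A kappa r, and
    \<open>l\<close> times r + d(x,y) dominates each of these terms.\<close>
  define l where "l = 1 + A * (1 + \<kappa>)"
  have l: "1 \<le> l" unfolding l_def using A_ge_1 assms by simp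
  obtain K where K: "1 \<le> K" "\<And>r x. 0 < r \<Longrightarrow> vol S (l * r) x \<le> K * vol S r x"
    using vol_dilate[of l] by blast
  show ?thesis
  proof (rule that)
    have "1 \<le> l powr g" using l assms(2) by (rule ge_one_powr_ge_zero)
    then show "1 \<le> l powr g * K" using K(1) by (metis mult_mono mult_1 zero_le_one order_trans)
    fix r x y u assume r: "0 < (r :: real)" and uy: "d u y \<le> \<kappa> * r"
    define t where "t = r + d x y"
    define t' where "t' = r + d x u"
    have t: "0 < t" "0 < t'" using r by (auto simp: t_def t'_def add_pos_nonneg)
    have "d x u \<le> A * (d x y + d u y)" using d_triangle[of x u y] by (simp add: d_commute)
    also have "\<dots> \<le> A * (d x y + \<kappa> * r)" using uy A_ge_1 by (intro mult_left_mono) auto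
    finally have "t' \<le> r + A * d x y + A * \<kappa> * r" by (simp add: t'_def algebra_simps)
    also have "\<dots> \<le> l * t"
    proof -
      have "0 \<le> A * r" "0 \<le> A * \<kappa> * d x y" using A_ge_1 assms r by auto
      moreover have "l * t = r + A * d x y + A * \<kappa> * r + (d x y + A * r + A * \<kappa> * d x y)"
        by (simp add: l_def t_def algebra_simps)
      ultimately show ?thesis using d_nonneg[of x y] by linarith
    qed
    finally have tt: "t' \<le> l * t" .
    have "vol S t' x \<le> vol S (l * t) x" using tt by (rule vol_mono)
    also have "\<dots> \<le> K * vol S t x" using K(2)[OF t(1)] .
    finally have v: "1 / vol S t x \<le> K / vol S t' x"
      using vol_pos[OF t(1)] vol_pos[OF t(2)] by (simp add: divide_simps)
    have "r / t \<le> l * (r / t')"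
      using tt t r by (simp add: divide_simps mult.commute)
    then have "(r / t) powr g \<le> (l * (r / t')) powr g"
      using t r assms by (intro powr_mono2) auto
    also have "\<dots> = l powr g * (r / t') powr g"
      by (rule powr_mult)
    finally have "(r / t) powr g * (1 / vol S t x) \<le> (l powr g * (r / t') powr g) * (K / vol S t' x)"
      using v by (intro mult_mono) auto
    then show "hker g r x y \<le> l powr g * K * hker g r x u"
      by (simp add: hker_def t_def t'_def mult_ac)
  qed
qed

text \<open>The right-hand side of the pointwise estimate is a sum over the dyadic annuli
  \<open>2\<^sup>n\<^sup>-\<^sup>1 r \<le> d x u < 2\<^sup>n r\<close>.\<close>

lemma hker_integral:
  assumes g: "0 < g"
  obtains K where "0 < K" "\<And>r x. 0 < r \<Longrightarrow> (\<integral>\<^sup>+u. ennreal (hker g r x u) \<partial>\<mu>) \<le> ennreal K"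
proof -
  \<comment> \<open>On the n-th annulus, n > 0, the ratio is at most 2^(1-n), and one doubling
    passes from the radius 2^(n-1) r to 2^n r. \<open>C\<close> collects the doubling constant and
    the factor 2^g due to the exponent n - 1 in place of n.\<close>
  define C where "C = dblconst S * 2 powr g"
  define h where "h = (2::real) powr (- g)"
  have C: "0 < C" unfolding C_def using dblconst_ge_1 by simp
  have h: "0 < h" "h < 1" unfolding h_def using g by (auto simp: powr_less_one)
  show ?thesis
  proof (rule that[of "C / (1 - h)"])
    show "0 < C / (1 - h)" using C h by simp
    fix r x assume r: "0 < (r :: real)"
    \<comment> \<open>Divided by the volume of the n-th ball, so that integration over that ball
      leaves a geometric series free of \<open>x\<close> and \<open>r\<close>.\<close>
    define a where "a n = C * h ^ n / vol S (2 ^ n * r) x" for n :: nat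
    have a: "0 \<le> a n" for n unfolding a_def using C h by simp
    have pw: "ennreal (hker g r x u)
        \<le> (\<Sum>n. ennreal (a n) * indicator (qball S x (2 ^ n * r)) u)" for u
    proof -
      obtain m :: nat where "d x u / r < 2 ^ m" using real_arch_pow[of 2 "d x u / r"] by auto
      then have ex: "d x u < 2 ^ m * r" using r by (simp add: divide_simps mult.commute)
      \<comment> \<open>Minimality gives the two cases: for n = 0 the point lies within r of the
        centre, otherwise it lies outside the preceding ball.\<close>
      define n where "n = (LEAST n. d x u < 2 ^ n * r)"
      have n: "d x u < 2 ^ n * r" unfolding n_def by (rule LeastI[of _ m]) (rule ex)
      have "hker g r x u \<le> a n"
      proof (cases n)
        case 0
        have p: "0 < r + d x u" using r by (simp add: add_pos_nonneg)
        have "hker g r x u \<le> 1 / vol S r x"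
          unfolding hker_def using r p g vol_pos[OF r] vol_pos[OF p]
          by (intro frac_le vol_mono powr_le1) (auto simp: divide_simps)
        also have "\<dots> \<le> C / vol S r x"
        proof -
          have "1 \<le> (2::real) powr g" using g by (intro ge_one_powr_ge_zero) auto
          then have "1 * 1 \<le> C" unfolding C_def using dblconst_ge_1 by (intro mult_mono) auto
          then show ?thesis by (intro divide_right_mono) auto
        qed
        finally show ?thesis by (simp add: a_def 0)
      next
        case (Suc m)
        have "\<not> d x u < 2 ^ m * r"
          using not_less_Least[of m "\<lambda>n. d x u < 2 ^ n * r"] Suc by (simp add: n_def)
        then have ge: "2 ^ m * r \<le> r + d x u" using r by simp
        have p: "0 < 2 ^ m * r" using r by simp
        have "r / (r + d x u) \<le> r / (2 ^ m * r)"
          using ge p r by (intro divide_left_mono) (auto intro!: mult_pos_pos add_pos_nonneg)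
        also have "\<dots> = inverse (2 ^ m)" using r by (simp add: field_simps)
        finally have "(r / (r + d x u)) powr g \<le> inverse (2 ^ m) powr g"
          using r g by (intro powr_mono2) auto
        also have "\<dots> = h ^ m"
          unfolding h_def by (simp add: powr_powr powr_minus power_inverse[symmetric]
              inverse_powr powr_realpow[symmetric] mult.commute)
        finally have num: "(r / (r + d x u)) powr g \<le> h ^ m" .
        have "vol S (2 ^ n * r) x \<le> dblconst S * vol S (2 ^ m * r) x"
          using vol_double[OF p, of x] Suc by (simp add: mult.assoc)
        also have "\<dots> \<le> dblconst S * vol S (r + d x u) x"
          using dblconst_ge_1 ge by (intro mult_left_mono vol_mono) auto
        finally have "vol S (2 ^ n * r) x \<le> dblconst S * vol S (r + d x u) x" .
        then have den: "1 / vol S (r + d x u) x \<le> dblconst S / vol S (2 ^ n * r) x"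
          using vol_pos[of "r + d x u" x] vol_pos[of "2 ^ n * r" x] r
          by (simp add: divide_simps add_pos_nonneg)
        have "hker g r x u \<le> h ^ m * (dblconst S / vol S (2 ^ n * r) x)"
          unfolding hker_def using mult_mono[OF num den] h by simp
        also have "\<dots> = a n"
          using Suc by (simp add: a_def C_def h_def powr_minus field_simps)
        finally show ?thesis .
      qed
      then have "ennreal (hker g r x u) \<le> ennreal (a n) * indicator (qball S x (2 ^ n * r)) u"
        using n by (simp add: qball_def ennreal_leI)
      also have "\<dots> \<le> (\<Sum>n. ennreal (a n) * indicator (qball S x (2 ^ n * r)) u)"
        using sum_le_suminf[of "\<lambda>n. ennreal (a n) * indicator (qball S x (2 ^ n * r)) u" "{n}"]
        by (simp del: sum_mult_indicator)
      finally show ?thesis .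
    qed
    have "(\<integral>\<^sup>+u. ennreal (hker g r x u) \<partial>\<mu>)
        \<le> (\<integral>\<^sup>+u. (\<Sum>n. ennreal (a n) * indicator (qball S x (2 ^ n * r)) u) \<partial>\<mu>)"
      by (intro nn_integral_mono pw)
    also have "\<dots> = (\<Sum>n. \<integral>\<^sup>+u. ennreal (a n) * indicator (qball S x (2 ^ n * r)) u \<partial>\<mu>)"
      by (intro nn_integral_suminf) measurable
    also have "\<dots> = (\<Sum>n. ennreal (C * h ^ n))"
    proof (intro suminf_cong)
      fix n
      have "(\<integral>\<^sup>+u. ennreal (a n) * indicator (qball S x (2 ^ n * r)) u \<partial>\<mu>)
          = ennreal (a n * vol S (2 ^ n * r) x)"
        using a by (simp add: nn_integral_cmult_indicator emeasure_qball ennreal_mult)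
      also have "a n * vol S (2 ^ n * r) x = C * h ^ n"
        using vol_pos[of "2 ^ n * r" x] r by (simp add: a_def)
      finally show "(\<integral>\<^sup>+u. ennreal (a n) * indicator (qball S x (2 ^ n * r)) u \<partial>\<mu>)
          = ennreal (C * h ^ n)" .
    qed
    also have "\<dots> = ennreal (C / (1 - h))"
    proof (rule suminf_ennreal_eq)
      show "0 \<le> C * h ^ n" for n using C h by simp
      have "(\<lambda>n. C * h ^ n) sums (C * (1 / (1 - h)))"
        using h by (intro sums_mult geometric_sums) simp
      then show "(\<lambda>n. C * h ^ n) sums (C / (1 - h))" by simp
    qed
    finally show "(\<integral>\<^sup>+u. ennreal (hker g r x u) \<partial>\<mu>) \<le> ennreal (C / (1 - h))" by simp
  qed
qed

text \<open>Discrete form of \<open>hker_integral\<close>: by \<open>hker_shift\<close> each summand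
  is at most a constant times the integral of the kernel over \<open>E p\<close>, and by
  disjointness these integrals add up to at most the integral over the space. Finite
  \<open>P\<close> is what partial sums of an unordered series require.\<close>

lemma hker_sum:
  assumes "0 \<le> \<kappa>" "0 < g"
  obtains K where "0 < K"
    "\<And>(P :: 'p set) E y r x.
      0 < r \<Longrightarrow> finite P \<Longrightarrow> disjoint_family_on E P \<Longrightarrow> (\<And>p. p \<in> P \<Longrightarrow> E p \<in> sets \<mu>) \<Longrightarrow>
      (\<And>p u. p \<in> P \<Longrightarrow> u \<in> E p \<Longrightarrow> d u (y p) \<le> \<kappa> * r) \<Longrightarrow>
      (\<Sum>p\<in>P. emeasure \<mu> (E p) * ennreal (hker g r x (y p))) \<le> ennreal K"
proof -
  obtain K where K: "1 \<le> K"
    "\<And>r x y u. 0 < r \<Longrightarrow> d u y \<le> \<kappa> * r \<Longrightarrow> hker g r x y \<le> K * hker g r x u"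
    using hker_shift[of \<kappa> g] assms by auto
  obtain L where L: "0 < L" "\<And>r x. 0 < r \<Longrightarrow> (\<integral>\<^sup>+u. ennreal (hker g r x u) \<partial>\<mu>) \<le> ennreal L"
    using hker_integral[OF assms(2)] by blast
  show ?thesis
  proof (rule that[of "K * L"])
    show "0 < K * L" using K(1) L(1) by simp
    fix P :: "'p set" and E y r x
    assume r: "0 < (r :: real)" and fin: "finite P" and disj: "disjoint_family_on E P"
      and E: "\<And>p. p \<in> P \<Longrightarrow> E p \<in> sets \<mu>"
      and diam: "\<And>p u. p \<in> P \<Longrightarrow> u \<in> E p \<Longrightarrow> d u (y p) \<le> \<kappa> * r"
    have "(\<Sum>p\<in>P. emeasure \<mu> (E p) * ennreal (hker g r x (y p)))
        = (\<Sum>p\<in>P. \<integral>\<^sup>+u. ennreal (hker g r x (y p)) * indicator (E p) u \<partial>\<mu>)"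
      using E by (intro sum.cong refl) (simp add: nn_integral_cmult_indicator, simp add: mult.commute)
    also have "\<dots> \<le> (\<Sum>p\<in>P. \<integral>\<^sup>+u. ennreal (K * hker g r x u) * indicator (E p) u \<partial>\<mu>)"
    proof (intro sum_mono nn_integral_mono)
      fix p u assume "p \<in> P"
      then show "ennreal (hker g r x (y p)) * indicator (E p) u
          \<le> ennreal (K * hker g r x u) * indicator (E p) u"
        using K(2)[OF r diam] by (auto simp: indicator_def intro!: ennreal_leI)
    qed
    also have "\<dots> = (\<integral>\<^sup>+u. (\<Sum>p\<in>P. ennreal (K * hker g r x u) * indicator (E p) u) \<partial>\<mu>)"
      using E by (intro nn_integral_sum[symmetric] borel_measurable_times_ennreal) auto
    also have "\<dots> = (\<integral>\<^sup>+u. ennreal (K * hker g r x u) * indicator (\<Union>p\<in>P. E p) u \<partial>\<mu>)"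
      using fin disj by (simp add: sum_distrib_left[symmetric] indicator_UN_disjoint)
    also have "\<dots> \<le> (\<integral>\<^sup>+u. ennreal K * ennreal (hker g r x u) \<partial>\<mu>)"
      using K(1) by (intro nn_integral_mono) (auto simp: indicator_def ennreal_mult)
    also have "\<dots> = ennreal K * (\<integral>\<^sup>+u. ennreal (hker g r x u) \<partial>\<mu>)"
      by (intro nn_integral_cmult) measurable
    also have "\<dots> \<le> ennreal K * ennreal L" by (intro mult_left_mono L(2) r) simp
    also have "\<dots> = ennreal (K * L)" using K(1) L(1) by (simp add: ennreal_mult)
    finally show "(\<Sum>p\<in>P. emeasure \<mu> (E p) * ennreal (hker g r x (y p))) \<le> ennreal (K * L)" .
  qed
qed

text \<open>The two weights call for opposite orders. With the weight at \<open>x\<close> one sums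
  over \<open>p\<close> first and then integrates the weight; with the weight at \<open>y p\<close>
  one integrates the kernel first and then sums the weight.\<close>

lemma two_hker_sum:
  assumes "0 \<le> \<kappa>" "0 < g" "0 < g'"
  obtains K where "0 < K"
    "\<And>(P :: 'p set) E y r x\<^sub>0.
      0 < r \<Longrightarrow> r \<le> 1 \<Longrightarrow> finite P \<Longrightarrow> disjoint_family_on E P \<Longrightarrow>
      (\<And>p. p \<in> P \<Longrightarrow> E p \<in> sets \<mu>) \<Longrightarrow>
      (\<And>p u. p \<in> P \<Longrightarrow> u \<in> E p \<Longrightarrow> d u (y p) \<le> \<kappa> * r) \<Longrightarrow>
      (\<Sum>p\<in>P. emeasure \<mu> (E p) * (\<integral>\<^sup>+x. ennreal (hker g r (y p) x *
         (hker g' 1 x\<^sub>0 x + hker g' 1 x\<^sub>0 (y p))) \<partial>\<mu>)) \<le> ennreal K"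
proof -
  obtain K where K: "1 \<le> K" "\<And>g r x y. 0 < r \<Longrightarrow> hker g r x y \<le> K * hker g r y x"
    using hker_commute_le by blast
  obtain L where L: "0 < L" "\<And>r x. 0 < r \<Longrightarrow> (\<integral>\<^sup>+u. ennreal (hker g r x u) \<partial>\<mu>) \<le> ennreal L"
    using hker_integral[OF assms(2)] by blast
  obtain L' where L': "0 < L'" "\<And>r x. 0 < r \<Longrightarrow> (\<integral>\<^sup>+u. ennreal (hker g' r x u) \<partial>\<mu>) \<le> ennreal L'"
    using hker_integral[OF assms(3)] by blast
  obtain M where M: "0 < M"
    "\<And>(P :: 'p set) E y r x.
      0 < r \<Longrightarrow> finite P \<Longrightarrow> disjoint_family_on E P \<Longrightarrow> (\<And>p. p \<in> P \<Longrightarrow> E p \<in> sets \<mu>) \<Longrightarrow>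
      (\<And>p u. p \<in> P \<Longrightarrow> u \<in> E p \<Longrightarrow> d u (y p) \<le> \<kappa> * r) \<Longrightarrow>
      (\<Sum>p\<in>P. emeasure \<mu> (E p) * ennreal (hker g r x (y p))) \<le> ennreal M"
    using hker_sum[OF assms(1,2)] by blast
  obtain M' where M': "0 < M'"
    "\<And>(P :: 'p set) E y r x.
      0 < r \<Longrightarrow> finite P \<Longrightarrow> disjoint_family_on E P \<Longrightarrow> (\<And>p. p \<in> P \<Longrightarrow> E p \<in> sets \<mu>) \<Longrightarrow>
      (\<And>p u. p \<in> P \<Longrightarrow> u \<in> E p \<Longrightarrow> d u (y p) \<le> \<kappa> * r) \<Longrightarrow>
      (\<Sum>p\<in>P. emeasure \<mu> (E p) * ennreal (hker g' r x (y p))) \<le> ennreal M'"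
    using hker_sum[OF assms(1,3)] by blast
  show ?thesis
  proof (rule that[of "K * M * L' + L * M'"])
    show "0 < K * M * L' + L * M'" using K(1) L(1) L'(1) M(1) M'(1) by (simp add: add_pos_pos)
    fix P :: "'p set" and E y r x\<^sub>0
    assume r: "0 < (r :: real)" "r \<le> 1" and fin: "finite P" and disj: "disjoint_family_on E P"
      and E: "\<And>p. p \<in> P \<Longrightarrow> E p \<in> sets \<mu>"
      and diam: "\<And>p u. p \<in> P \<Longrightarrow> u \<in> E p \<Longrightarrow> d u (y p) \<le> \<kappa> * r"
    \<comment> \<open>The weight lives at scale 1. Since r <= 1, sets that are small at scale r are
      also small at scale 1, and \<open>hker_sum\<close> applies to the weight.\<close>
    have diam1: "d u (y p) \<le> \<kappa> * 1" if "p \<in> P" "u \<in> E p" for p u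
      using diam[OF that] mult_left_mono[OF r(2) assms(1)] by linarith
    let ?H = "hker g' 1 x\<^sub>0"
    have "(\<Sum>p\<in>P. emeasure \<mu> (E p) * (\<integral>\<^sup>+x. ennreal (hker g r (y p) x * ?H x) \<partial>\<mu>))
        = (\<Sum>p\<in>P. \<integral>\<^sup>+x. emeasure \<mu> (E p) * ennreal (hker g r (y p) x * ?H x) \<partial>\<mu>)"
      by (intro sum.cong nn_integral_cmult[symmetric]) measurable
    also have "\<dots> = (\<integral>\<^sup>+x. (\<Sum>p\<in>P. emeasure \<mu> (E p) * ennreal (hker g r (y p) x * ?H x)) \<partial>\<mu>)"
      by (intro nn_integral_sum[symmetric]) measurable
    also have "\<dots> \<le> (\<integral>\<^sup>+x. ennreal (K * M) * ennreal (?H x) \<partial>\<mu>)"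
    proof (intro nn_integral_mono)
      fix x
      have "(\<Sum>p\<in>P. emeasure \<mu> (E p) * ennreal (hker g r (y p) x * ?H x))
          \<le> (\<Sum>p\<in>P. ennreal (K * ?H x) * (emeasure \<mu> (E p) * ennreal (hker g r x (y p))))"
      proof (rule sum_mono)
        fix p assume "p \<in> P"
        \<comment> \<open>The sum runs over the centres \<open>y p\<close>, so the kernel is first
          recentred at the fixed point \<open>x\<close>.\<close>
        have "hker g r (y p) x * ?H x \<le> K * hker g r x (y p) * ?H x"
          by (intro mult_right_mono K(2) r) simp
        then have "emeasure \<mu> (E p) * ennreal (hker g r (y p) x * ?H x)
            \<le> emeasure \<mu> (E p) * ennreal (K * ?H x * hker g r x (y p))"
          by (intro mult_left_mono ennreal_leI) (auto simp: mult_ac)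
        also have "\<dots> = ennreal (K * ?H x) * (emeasure \<mu> (E p) * ennreal (hker g r x (y p)))"
          using K(1) by (subst ennreal_mult) (auto simp: mult_ac)
        finally show "emeasure \<mu> (E p) * ennreal (hker g r (y p) x * ?H x)
            \<le> ennreal (K * ?H x) * (emeasure \<mu> (E p) * ennreal (hker g r x (y p)))" .
      qed
      also have "\<dots> = ennreal (K * ?H x) * (\<Sum>p\<in>P. emeasure \<mu> (E p) * ennreal (hker g r x (y p)))"
        by (simp add: sum_distrib_left)
      also have "\<dots> \<le> ennreal (K * ?H x) * ennreal M"
        by (intro mult_left_mono M(2)[OF r(1) fin disj E diam]) auto
      also have "\<dots> = ennreal (K * M) * ennreal (?H x)"
        using K(1) M(1) by (simp add: ennreal_mult[symmetric] mult_ac)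
      finally show "(\<Sum>p\<in>P. emeasure \<mu> (E p) * ennreal (hker g r (y p) x * ?H x))
          \<le> ennreal (K * M) * ennreal (?H x)" .
    qed
    also have "\<dots> = ennreal (K * M) * (\<integral>\<^sup>+x. ennreal (?H x) \<partial>\<mu>)"
      by (intro nn_integral_cmult) measurable
    also have "\<dots> \<le> ennreal (K * M) * ennreal L'" by (intro mult_left_mono L'(2)) auto
    also have "\<dots> = ennreal (K * M * L')" using K(1) M(1) L'(1) by (simp add: ennreal_mult)
    finally have 1: "(\<Sum>p\<in>P. emeasure \<mu> (E p) * (\<integral>\<^sup>+x. ennreal (hker g r (y p) x * ?H x) \<partial>\<mu>))
        \<le> ennreal (K * M * L')" .
    have "(\<Sum>p\<in>P. emeasure \<mu> (E p) * (\<integral>\<^sup>+x. ennreal (hker g r (y p) x * ?H (y p)) \<partial>\<mu>))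
        \<le> (\<Sum>p\<in>P. ennreal L * (emeasure \<mu> (E p) * ennreal (?H (y p))))"
    proof (rule sum_mono)
      fix p assume "p \<in> P"
      have "(\<integral>\<^sup>+x. ennreal (hker g r (y p) x * ?H (y p)) \<partial>\<mu>)
          = (\<integral>\<^sup>+x. ennreal (hker g r (y p) x) * ennreal (?H (y p)) \<partial>\<mu>)"
        by (simp add: ennreal_mult)
      also have "\<dots> = (\<integral>\<^sup>+x. ennreal (hker g r (y p) x) \<partial>\<mu>) * ennreal (?H (y p))"
        by (intro nn_integral_multc) measurable
      also have "\<dots> \<le> ennreal L * ennreal (?H (y p))" by (intro mult_right_mono L(2) r) simp
      finally have "emeasure \<mu> (E p) * (\<integral>\<^sup>+x. ennreal (hker g r (y p) x * ?H (y p)) \<partial>\<mu>)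
          \<le> emeasure \<mu> (E p) * (ennreal L * ennreal (?H (y p)))"
        by (intro mult_left_mono) auto
      then show "emeasure \<mu> (E p) * (\<integral>\<^sup>+x. ennreal (hker g r (y p) x * ?H (y p)) \<partial>\<mu>)
          \<le> ennreal L * (emeasure \<mu> (E p) * ennreal (?H (y p)))"
        by (simp add: mult_ac)
    qed
    also have "\<dots> = ennreal L * (\<Sum>p\<in>P. emeasure \<mu> (E p) * ennreal (?H (y p)))"
      by (simp add: sum_distrib_left)
    also have "\<dots> \<le> ennreal L * ennreal M'"
      by (intro mult_left_mono M'(2)[OF _ fin disj E diam1]) auto
    also have "\<dots> = ennreal (L * M')" using L(1) M'(1) by (simp add: ennreal_mult)
    finally have 2: "(\<Sum>p\<in>P. emeasure \<mu> (E p) *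
        (\<integral>\<^sup>+x. ennreal (hker g r (y p) x * ?H (y p)) \<partial>\<mu>)) \<le> ennreal (L * M')" .
    have "(\<integral>\<^sup>+x. ennreal (hker g r (y p) x * (?H x + ?H (y p))) \<partial>\<mu>)
        = (\<integral>\<^sup>+x. ennreal (hker g r (y p) x * ?H x) \<partial>\<mu>)
          + (\<integral>\<^sup>+x. ennreal (hker g r (y p) x * ?H (y p)) \<partial>\<mu>)" for p
      by (subst nn_integral_add[symmetric]) (auto simp: distrib_left intro!: nn_integral_cong)
    then have "(\<Sum>p\<in>P. emeasure \<mu> (E p) * (\<integral>\<^sup>+x. ennreal (hker g r (y p) x *
         (?H x + ?H (y p))) \<partial>\<mu>))
      = (\<Sum>p\<in>P. emeasure \<mu> (E p) * (\<integral>\<^sup>+x. ennreal (hker g r (y p) x * ?H x) \<partial>\<mu>))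
        + (\<Sum>p\<in>P. emeasure \<mu> (E p) * (\<integral>\<^sup>+x. ennreal (hker g r (y p) x * ?H (y p)) \<partial>\<mu>))"
      by (simp add: distrib_left sum.distrib)
    also have "\<dots> \<le> ennreal (K * M * L') + ennreal (L * M')" using 1 2 by (rule add_mono)
    also have "\<dots> = ennreal (K * M * L' + L * M')"
      using K(1) M(1) L(1) L'(1) M'(1) by (simp add: ennreal_plus)
    finally show "(\<Sum>p\<in>P. emeasure \<mu> (E p) * (\<integral>\<^sup>+x. ennreal (hker g r (y p) x *
         (?H x + ?H (y p))) \<partial>\<mu>)) \<le> ennreal (K * M * L' + L * M')" .
  qed
qed

section \<open>The prescribed majorants in terms of \<open>hker\<close>\<close>

lemma vol_sum_le:
  assumes "0 < r" "0 \<le> t"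
  shows "vol S (r + t) x \<le> dblconst S * (vol S r x + vol S t x)"
proof -
  have "vol S (r + t) x \<le> vol S (2 * max r t) x" by (intro vol_mono) simp
  also have "\<dots> \<le> dblconst S * vol S (max r t) x" using assms by (intro vol_double) simp
  also have "\<dots> \<le> dblconst S * (vol S r x + vol S t x)"
    using dblconst_ge_1 by (intro mult_left_mono) (auto simp: max_def)
  finally show ?thesis .
qed

text \<open>Replaces the sum of two volumes in the denominators by the volume of one ball, of radius
  r + d(x,y). For x = y the second volume is that of an empty ball, which \<open>vol_sum_le\<close>
  covers through t = 0.\<close>

lemma inverse_vol_sum_le:
  assumes "0 < r"
  shows "1 / (vol S r x + volxy S x y) \<le> dblconst S / vol S (r + d x y) x"
proof -
  have "0 < vol S (r + d x y) x" using assms by (intro vol_pos add_pos_nonneg) auto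
  moreover have "0 < vol S r x + volxy S x y"
    using vol_pos[OF assms] by (simp add: volxy_def add_pos_nonneg)
  ultimately show ?thesis
    using vol_sum_le[OF assms d_nonneg, of x y x] by (simp add: volxy_def divide_simps)
qed

lemma poly_bound_le_hker:
  assumes "0 < mesh S"
  shows "poly_bound S g k x y \<le> dblconst S * hker g (mesh S ^ k) x y"
  using mult_right_mono[OF inverse_vol_sum_le[of "mesh S ^ k" x y],
      of "(mesh S ^ k / (mesh S ^ k + d x y)) powr g"] assms
  by (simp add: poly_bound_def hker_def mult_ac)

lemma test_decay_nonneg [simp]: "0 \<le> test_decay S g x"
  by (simp add: test_decay_def volxy_def)

lemma test_decay_le_hker: "test_decay S g x \<le> dblconst S * hker g 1 (basept S) x"
proof -
  have "(1 + d (basept S) x) powr (- g) = (1 / (1 + d (basept S) x)) powr g"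
    by (simp add: powr_minus powr_divide divide_simps)
  then show ?thesis
    using mult_right_mono[OF inverse_vol_sum_le[of 1 "basept S" x],
        of "(1 + d (basept S) x) powr (- g)"]
    by (simp add: test_decay_def hker_def mult_ac)
qed

end

section \<open>Extension of bounded functionals from a dense subspace\<close>

definition linear_fun :: "('a \<Rightarrow> complex) set \<Rightarrow> (('a \<Rightarrow> complex) \<Rightarrow> complex) \<Rightarrow> bool" where
  "linear_fun U f \<longleftrightarrow>
     (\<forall>\<phi>\<in>U. \<forall>\<psi>\<in>U. \<forall>a b. f (\<lambda>x. a * \<phi> x + b * \<psi> x) = a * f \<phi> + b * f \<psi>)"

lemma linear_funD:
  "linear_fun U f \<Longrightarrow> \<phi> \<in> U \<Longrightarrow> \<psi> \<in> U \<Longrightarrow> f (\<lambda>x. a * \<phi> x + b * \<psi> x) = a * f \<phi> + b * f \<psi>"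
  by (simp add: linear_fun_def)

lemma linear_fun_diff:
  "linear_fun U f \<Longrightarrow> \<phi> \<in> U \<Longrightarrow> \<psi> \<in> U \<Longrightarrow> f (\<lambda>x. \<phi> x - \<psi> x) = f \<phi> - f \<psi>"
  using linear_funD[of U f \<phi> \<psi> 1 "-1"] by simp

text \<open>\<open>V\<close> will be the closure of \<open>W\<close> = G(eta, eta) in the second
  space and \<open>p\<close> the norm there. The triangle inequality and homogeneity enter as one
  estimate for linear combinations, which is the form in which constants of test functions
  combine.\<close>

locale seminorm_dense =
  fixes V W :: "('a \<Rightarrow> complex) set" and p :: "('a \<Rightarrow> complex) \<Rightarrow> real"
  assumes V_lin: "\<And>\<phi> \<psi> a b. \<phi> \<in> V \<Longrightarrow> \<psi> \<in> V \<Longrightarrow> (\<lambda>x. a * \<phi> x + b * \<psi> x) \<in> V"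
    and W_lin: "\<And>\<phi> \<psi> a b. \<phi> \<in> W \<Longrightarrow> \<psi> \<in> W \<Longrightarrow> (\<lambda>x. a * \<phi> x + b * \<psi> x) \<in> W"
    and W_sub: "W \<subseteq> V"
    and p_nonneg: "\<And>\<phi>. \<phi> \<in> V \<Longrightarrow> 0 \<le> p \<phi>"
    and p_lin: "\<And>\<phi> \<psi> a b. \<phi> \<in> V \<Longrightarrow> \<psi> \<in> V \<Longrightarrow>
      p (\<lambda>x. a * \<phi> x + b * \<psi> x) \<le> cmod a * p \<phi> + cmod b * p \<psi>"
    and dense: "\<And>\<phi> e. \<phi> \<in> V \<Longrightarrow> 0 < e \<Longrightarrow> \<exists>w\<in>W. p (\<lambda>x. \<phi> x - w x) < e"
begin

lemma V_diff: "\<phi> \<in> V \<Longrightarrow> \<psi> \<in> V \<Longrightarrow> (\<lambda>x. \<phi> x - \<psi> x) \<in> V"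
  using V_lin[of \<phi> \<psi> 1 "-1"] by simp

lemma W_diff: "\<phi> \<in> W \<Longrightarrow> \<psi> \<in> W \<Longrightarrow> (\<lambda>x. \<phi> x - \<psi> x) \<in> W"
  using W_lin[of \<phi> \<psi> 1 "-1"] by simp

lemma p_diff_self: "\<phi> \<in> V \<Longrightarrow> p (\<lambda>x. \<phi> x - \<phi> x) = 0"
  using p_lin[of \<phi> \<phi> 0 0] p_nonneg[OF V_diff[of \<phi> \<phi>]] by simp

lemma p_triangle:
  assumes "\<phi> \<in> V" "u \<in> V" "v \<in> V"
  shows "p (\<lambda>x. u x - v x) \<le> p (\<lambda>x. \<phi> x - u x) + p (\<lambda>x. \<phi> x - v x)"
  using p_lin[OF V_diff[OF assms(1,2)] V_diff[OF assms(1,3)], of "-1" 1] by simp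

lemma p_le_diff:
  assumes "\<phi> \<in> V" "u \<in> V"
  shows "p u \<le> p \<phi> + p (\<lambda>x. \<phi> x - u x)"
  using p_lin[OF assms(1) V_diff[OF assms], of 1 "-1"] by simp

context
  fixes f and K :: real
  assumes lin: "linear_fun W f"
    and bdd: "\<And>w. w \<in> W \<Longrightarrow> cmod (f w) \<le> K * p w"
    and K: "0 \<le> K"
begin

lemma bounded_diff:
  assumes "\<phi> \<in> V" "u \<in> W" "v \<in> W"
  shows "cmod (f u - f v) \<le> K * p (\<lambda>x. \<phi> x - u x) + K * p (\<lambda>x. \<phi> x - v x)"
proof -
  have "cmod (f u - f v) \<le> K * p (\<lambda>x. u x - v x)"
    using bdd[OF W_diff[OF assms(2,3)]] linear_fun_diff[OF lin assms(2,3)] by simp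
  also have "\<dots> \<le> K * (p (\<lambda>x. \<phi> x - u x) + p (\<lambda>x. \<phi> x - v x))"
    using assms W_sub K by (intro mult_left_mono p_triangle) auto
  finally show ?thesis by (simp add: distrib_left)
qed

text \<open>Completeness of the complex numbers: by \<open>bounded_diff\<close> the values along a
  sequence of \<open>W\<close> converging to the given function are Cauchy. The limit is recorded by
  an inequality against every \<open>u\<close> in \<open>W\<close>, which no longer mentions the
  sequence and from which all properties of the extension follow.\<close>

lemma ex_value:
  assumes V: "\<phi> \<in> V"
  shows "\<exists>L. \<forall>u\<in>W. cmod (f u - L) \<le> K * p (\<lambda>x. \<phi> x - u x)"
proof -
  have "\<exists>w\<in>W. p (\<lambda>x. \<phi> x - w x) < inverse (real (Suc n))" for n
    using dense[OF V] by simp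
  then obtain w where wW: "\<And>n. w n \<in> W" and w: "\<And>n. p (\<lambda>x. \<phi> x - w n x) < inverse (real (Suc n))"
    by metis
  have "(\<lambda>n. p (\<lambda>x. \<phi> x - w n x)) \<longlonglongrightarrow> 0"
  proof (rule tendsto_sandwich[OF _ _ tendsto_const LIMSEQ_inverse_real_of_nat])
    show "\<forall>\<^sub>F n in sequentially. 0 \<le> p (\<lambda>x. \<phi> x - w n x)"
      using W_sub wW V by (intro always_eventually allI p_nonneg V_diff) auto
    show "\<forall>\<^sub>F n in sequentially. p (\<lambda>x. \<phi> x - w n x) \<le> inverse (real (Suc n))"
      using w by (intro always_eventually allI less_imp_le)
  qed
  then have lim0: "(\<lambda>n. K * p (\<lambda>x. \<phi> x - w n x)) \<longlonglongrightarrow> 0"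
    using tendsto_mult_right_zero by blast
  have "Cauchy (\<lambda>n. f (w n))"
  proof (rule metric_CauchyI)
    fix e :: real assume "0 < e"
    then have "\<forall>\<^sub>F n in sequentially. K * p (\<lambda>x. \<phi> x - w n x) < e / 2"
      using lim0 by (intro order_tendstoD) auto
    then obtain M where M: "\<And>n. M \<le> n \<Longrightarrow> K * p (\<lambda>x. \<phi> x - w n x) < e / 2"
      by (auto simp: eventually_sequentially)
    show "\<exists>M. \<forall>m\<ge>M. \<forall>n\<ge>M. dist (f (w m)) (f (w n)) < e"
    proof (intro exI allI impI)
      fix m n assume "M \<le> m" "M \<le> n"
      then show "dist (f (w m)) (f (w n)) < e"
        using bounded_diff[OF V wW wW, of m n] M[of m] M[of n] unfolding dist_norm by linarith
    qed
  qed
  then obtain L where L: "(\<lambda>n. f (w n)) \<longlonglongrightarrow> L"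
    using Cauchy_convergent convergent_def by blast
  have "cmod (f u - L) \<le> K * p (\<lambda>x. \<phi> x - u x)" if u: "u \<in> W" for u
  proof -
    have 1: "(\<lambda>n. cmod (f u - f (w n))) \<longlonglongrightarrow> cmod (f u - L)"
      by (intro tendsto_intros L)
    have 2: "(\<lambda>n. K * p (\<lambda>x. \<phi> x - u x) + K * p (\<lambda>x. \<phi> x - w n x)) \<longlonglongrightarrow> K * p (\<lambda>x. \<phi> x - u x) + 0"
      by (intro tendsto_add tendsto_const lim0)
    show ?thesis
      using LIMSEQ_le[OF 1 2] bounded_diff[OF V u wW] by auto
  qed
  then show ?thesis by blast
qed

text \<open>The bound with \<open>K\<close> holds for every bounded extension, whatever constant
  that extension came with, because by uniqueness it coincides with the one constructed
  here.\<close>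

lemma ex1_bounded_extension:
  "\<exists>!g. g \<in> extensional V \<and> linear_fun V g \<and> (\<exists>C. \<forall>\<phi>\<in>V. cmod (g \<phi>) \<le> C * p \<phi>) \<and>
        (\<forall>\<phi>\<in>W. g \<phi> = f \<phi>)"
  and bounded_extension_le:
  "g \<in> extensional V \<Longrightarrow> linear_fun V g \<Longrightarrow> \<exists>C. \<forall>\<phi>\<in>V. cmod (g \<phi>) \<le> C * p \<phi> \<Longrightarrow>
   \<forall>\<phi>\<in>W. g \<phi> = f \<phi> \<Longrightarrow> \<phi> \<in> V \<Longrightarrow> cmod (g \<phi>) \<le> K * p \<phi>"
proof -
  \<comment> \<open>By density at most one \<open>L\<close> satisfies the inequality, so the choice
    is harmless; linearity and the bound are obtained by inserting good approximations
    \<open>u\<close>.\<close>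
  define h where "h = (\<lambda>\<phi>\<in>V. SOME L. \<forall>u\<in>W. cmod (f u - L) \<le> K * p (\<lambda>x. \<phi> x - u x))"
  have h: "cmod (f u - h \<phi>) \<le> K * p (\<lambda>x. \<phi> x - u x)" if "\<phi> \<in> V" "u \<in> W" for \<phi> u
    using someI_ex[OF ex_value[OF that(1)]] that by (simp add: h_def)
  have h_ext: "h \<in> extensional V" by (simp add: h_def)
  have h_W: "h \<phi> = f \<phi>" if "\<phi> \<in> W" for \<phi>
    \<comment> \<open>A function of \<open>W\<close> is its own approximation, at distance
      0.\<close>
    using h[of \<phi> \<phi>] that W_sub p_diff_self[of \<phi>] by auto
  have h_bdd: "cmod (h \<phi>) \<le> K * p \<phi>" if V: "\<phi> \<in> V" for \<phi>
  proof (rule le_of_forall_pos_le_mult)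
    fix e :: real assume "0 < e"
    then obtain u where u: "u \<in> W" "p (\<lambda>x. \<phi> x - u x) < e" using dense[OF V] by blast
    have "cmod (h \<phi>) \<le> cmod (f u) + cmod (f u - h \<phi>)"
      by (metis norm_triangle_sub norm_minus_commute)
    also have "\<dots> \<le> K * p u + K * p (\<lambda>x. \<phi> x - u x)" by (intro add_mono bdd h u V)
    also have "\<dots> \<le> K * (p \<phi> + p (\<lambda>x. \<phi> x - u x)) + K * p (\<lambda>x. \<phi> x - u x)"
      using u W_sub V K by (intro add_right_mono mult_left_mono p_le_diff) auto
    also have "\<dots> \<le> K * (p \<phi> + e) + K * e"
      using u(2) K by (intro add_mono mult_left_mono add_left_mono) auto
    finally show "cmod (h \<phi>) \<le> K * p \<phi> + 2 * K * e" by (simp add: algebra_simps)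
  qed (use K in simp)
  have h_lin: "linear_fun V h"
    unfolding linear_fun_def
  proof (intro ballI allI)
    fix \<phi> \<psi> a b assume V: "\<phi> \<in> V" "\<psi> \<in> V"
    let ?\<chi> = "\<lambda>x. a * \<phi> x + b * \<psi> x"
    have "cmod (h ?\<chi> - (a * h \<phi> + b * h \<psi>)) \<le> 0"
    proof (rule le_of_forall_pos_le_mult)
      fix e :: real assume "0 < e"
      then obtain u v where u: "u \<in> W" "p (\<lambda>x. \<phi> x - u x) < e"
        and v: "v \<in> W" "p (\<lambda>x. \<psi> x - v x) < e"
        using dense V by meson
      let ?w = "\<lambda>x. a * u x + b * v x"
      let ?B = "K * (cmod a * p (\<lambda>x. \<phi> x - u x) + cmod b * p (\<lambda>x. \<psi> x - v x))"
      have "cmod (f ?w - h ?\<chi>) \<le> K * p (\<lambda>x. ?\<chi> x - ?w x)"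
        by (intro h V_lin W_lin V u v)
      also have "(\<lambda>x. ?\<chi> x - ?w x) = (\<lambda>x. a * (\<phi> x - u x) + b * (\<psi> x - v x))"
        by (simp add: algebra_simps)
      also have "K * p \<dots> \<le> ?B"
        using u v V W_sub K by (intro mult_left_mono p_lin V_diff) auto
      finally have 1: "cmod (f ?w - h ?\<chi>) \<le> ?B" .
      have "f ?w - (a * h \<phi> + b * h \<psi>) = a * (f u - h \<phi>) + b * (f v - h \<psi>)"
        using linear_funD[OF lin u(1) v(1)] by (simp add: algebra_simps)
      also have "cmod \<dots> \<le> cmod a * cmod (f u - h \<phi>) + cmod b * cmod (f v - h \<psi>)"
        by (rule order_trans[OF norm_triangle_ineq]) (simp add: norm_mult)
      also have "\<dots> \<le> cmod a * (K * p (\<lambda>x. \<phi> x - u x)) + cmod b * (K * p (\<lambda>x. \<psi> x - v x))"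
        by (intro add_mono mult_left_mono h V u v) auto
      also have "\<dots> = ?B" by (simp add: algebra_simps)
      finally have 2: "cmod (f ?w - (a * h \<phi> + b * h \<psi>)) \<le> ?B" .
      have "cmod (h ?\<chi> - (a * h \<phi> + b * h \<psi>))
          = cmod ((f ?w - (a * h \<phi> + b * h \<psi>)) - (f ?w - h ?\<chi>))"
        by (intro arg_cong[of _ _ cmod]) (simp add: algebra_simps)
      also have "\<dots> \<le> ?B + ?B"
        by (rule order_trans[OF norm_triangle_ineq4 add_mono[OF 2 1]])
      also have "\<dots> = 2 * ?B" by simp
      also have "\<dots> \<le> 2 * (K * (cmod a * e + cmod b * e))"
        using u(2) v(2) K by (intro mult_left_mono add_mono) auto
      finally show "cmod (h ?\<chi> - (a * h \<phi> + b * h \<psi>)) \<le> 0 + 2 * K * (cmod a + cmod b) * e"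
        by (simp add: algebra_simps)
    qed (use K in simp)
    then show "h ?\<chi> = a * h \<phi> + b * h \<psi>" by simp
  qed
  have uniq: "g = h"
    if ext: "g \<in> extensional V" and g: "linear_fun V g" "\<exists>C. \<forall>\<phi>\<in>V. cmod (g \<phi>) \<le> C * p \<phi>"
      and W: "\<forall>\<phi>\<in>W. g \<phi> = f \<phi>" for g
  proof (rule extensionalityI[OF ext h_ext])
    fix \<phi> assume V: "\<phi> \<in> V"
    obtain C where C: "\<And>\<phi>. \<phi> \<in> V \<Longrightarrow> cmod (g \<phi>) \<le> C * p \<phi>" using g(2) by blast
    have "cmod (g \<phi> - h \<phi>) \<le> 0"
    proof (rule le_of_forall_pos_le_mult)
      fix e :: real assume "0 < e"
      then obtain u where u: "u \<in> W" "p (\<lambda>x. \<phi> x - u x) < e" using dense[OF V] by blast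
      have uV: "u \<in> V" using u W_sub by blast
      have p0: "0 \<le> p (\<lambda>x. \<phi> x - u x)" by (intro p_nonneg V_diff V uV)
      have "g \<phi> - h \<phi> = g (\<lambda>x. \<phi> x - u x) + (f u - h \<phi>)"
        using linear_fun_diff[OF g(1) V uV] W u by simp
      also have "cmod \<dots> \<le> C * p (\<lambda>x. \<phi> x - u x) + K * p (\<lambda>x. \<phi> x - u x)"
        by (intro order_trans[OF norm_triangle_ineq] add_mono C V_diff h V uV u)
      \<comment> \<open>The constant of an arbitrary bounded extension comes without a sign.\<close>
      also have "\<dots> \<le> (\<bar>C\<bar> + K) * p (\<lambda>x. \<phi> x - u x)"
        using p0 by (simp add: distrib_right mult_right_mono)
      also have "\<dots> \<le> (\<bar>C\<bar> + K) * e" using u(2) K by (intro mult_left_mono) auto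
      finally show "cmod (g \<phi> - h \<phi>) \<le> 0 + (\<bar>C\<bar> + K) * e" by simp
    qed (use K in simp)
    then show "g \<phi> = h \<phi>" by simp
  qed
  show "\<exists>!g. g \<in> extensional V \<and> linear_fun V g \<and> (\<exists>C. \<forall>\<phi>\<in>V. cmod (g \<phi>) \<le> C * p \<phi>) \<and>
        (\<forall>\<phi>\<in>W. g \<phi> = f \<phi>)"
    using h_ext h_lin h_bdd h_W uniq by (intro ex1I[of _ h]) blast+
  show "cmod (g \<phi>) \<le> K * p \<phi>"
    if "g \<in> extensional V" "linear_fun V g" "\<exists>C. \<forall>\<phi>\<in>V. cmod (g \<phi>) \<le> C * p \<phi>"
      "\<forall>\<phi>\<in>W. g \<phi> = f \<phi>" "\<phi> \<in> V"
    using uniq[OF that(1-4)] h_bdd[OF that(5)] by simp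
qed

end

end

section \<open>Test functions\<close>

context doubling_space
begin

lemma test_boundD:
  assumes "test_bound S \<beta> \<gamma> f C"
  shows "0 < C" "cmod (f x) \<le> C * test_decay S \<gamma> x"
    "d x y \<le> (1 + d (basept S) x) / (2 * A) \<Longrightarrow>
      cmod (f x - f y) \<le> C * (d x y / (1 + d (basept S) x)) powr \<beta> * test_decay S \<gamma> x"
  using assms by (simp_all add: test_bound_def)

lemma test_ratio_le_1:
  assumes "d x y \<le> (1 + d (basept S) x) / (2 * A)"
  shows "d x y / (1 + d (basept S) x) \<le> 1"
proof -
  have "(1 + d (basept S) x) / (2 * A) \<le> (1 + d (basept S) x) / 1"
    using A_ge_1 by (intro divide_left_mono) auto
  then have "d x y \<le> 1 + d (basept S) x" using assms by simp
  then show ?thesis using plus_d_pos[of 1 "basept S" x] by simp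
qed

text \<open>\<open>B\<close> is free because an admissible constant must be positive, whereas the
  natural value vanishes for a = b = 0.\<close>

lemma test_bound_lin:
  assumes f: "test_bound S \<beta> \<gamma> f C" and g: "test_bound S \<beta> \<gamma> g C'"
    and B: "0 < B" "cmod a * C + cmod b * C' \<le> B"
  shows "test_bound S \<beta> \<gamma> (\<lambda>x. a * f x + b * g x) B"
  unfolding test_bound_def
proof (intro conjI allI impI B(1))
  fix x
  have "cmod (a * f x + b * g x) \<le> cmod a * cmod (f x) + cmod b * cmod (g x)"
    by (rule order_trans[OF norm_triangle_ineq]) (simp add: norm_mult)
  also have "\<dots> \<le> cmod a * (C * test_decay S \<gamma> x) + cmod b * (C' * test_decay S \<gamma> x)"
    by (intro add_mono mult_left_mono test_boundD(2)[OF f] test_boundD(2)[OF g]) auto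
  also have "\<dots> = (cmod a * C + cmod b * C') * test_decay S \<gamma> x" by (simp add: algebra_simps)
  also have "\<dots> \<le> B * test_decay S \<gamma> x" by (intro mult_right_mono B) simp
  finally show "cmod (a * f x + b * g x) \<le> B * test_decay S \<gamma> x" .
next
  fix x y assume xy: "d x y \<le> (1 + d (basept S) x) / (2 * A)"
  let ?D = "(d x y / (1 + d (basept S) x)) powr \<beta> * test_decay S \<gamma> x"
  have "cmod (a * f x + b * g x - (a * f y + b * g y)) = cmod (a * (f x - f y) + b * (g x - g y))"
    by (simp add: algebra_simps)
  also have "\<dots> \<le> cmod a * cmod (f x - f y) + cmod b * cmod (g x - g y)"
    by (rule order_trans[OF norm_triangle_ineq]) (simp add: norm_mult)
  also have "\<dots> \<le> cmod a * (C * ?D) + cmod b * (C' * ?D)"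
    using test_boundD(3)[OF f xy] test_boundD(3)[OF g xy]
    by (intro add_mono mult_left_mono) (auto simp: mult.assoc)
  also have "\<dots> = (cmod a * C + cmod b * C') * ?D" by (simp add: algebra_simps)
  also have "\<dots> \<le> B * ?D" by (intro mult_right_mono B) simp
  finally show "cmod (a * f x + b * g x - (a * f y + b * g y))
      \<le> B * (d x y / (1 + d (basept S) x)) powr \<beta> * test_decay S \<gamma> x"
    by (simp add: mult.assoc)
qed

lemma test_bound_mono: "test_bound S \<beta> \<gamma> f C \<Longrightarrow> C \<le> B \<Longrightarrow> test_bound S \<beta> \<gamma> f B"
  using test_bound_lin[of \<beta> \<gamma> f C f C B 1 0] test_boundD(1)[of \<beta> \<gamma> f C] by simp

lemma test_norm_le: "test_bound S \<beta> \<gamma> f C \<Longrightarrow> test_norm S \<beta> \<gamma> f \<le> C"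
  unfolding test_norm_def
  by (intro cInf_lower bdd_belowI[of _ 0]) (auto dest: test_boundD(1))

lemma test_norm_nonneg: "f \<in> test_space S \<beta> \<gamma> \<Longrightarrow> 0 \<le> test_norm S \<beta> \<gamma> f"
  unfolding test_norm_def test_space_def
  by (intro cInf_greatest) (auto dest: test_boundD(1))

text \<open>The norm is an infimum, so an admissible constant is only obtained strictly above it;
  admissible constants can be enlarged.\<close>

lemma test_bound_of_norm_less:
  assumes "f \<in> test_space S \<beta> \<gamma>" "test_norm S \<beta> \<gamma> f < C"
  shows "test_bound S \<beta> \<gamma> f C"
proof -
  have "{C. test_bound S \<beta> \<gamma> f C} \<noteq> {}" using assms(1) by (auto simp: test_space_def)
  then obtain B where "test_bound S \<beta> \<gamma> f B" "B < C"
    using cInf_lessD[of "{C. test_bound S \<beta> \<gamma> f C}" C] assms(2) by (auto simp: test_norm_def)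
  then show ?thesis using test_bound_mono by (meson less_imp_le)
qed

lemma test_space_lin:
  assumes "f \<in> test_space S \<beta> \<gamma>" "g \<in> test_space S \<beta> \<gamma>"
  shows "(\<lambda>x. a * f x + b * g x) \<in> test_space S \<beta> \<gamma>"
proof -
  obtain C C' where C: "test_bound S \<beta> \<gamma> f C" and C': "test_bound S \<beta> \<gamma> g C'"
    using assms by (auto simp: test_space_def)
  have "0 \<le> cmod a * C" "0 \<le> cmod b * C'" using test_boundD(1)[OF C] test_boundD(1)[OF C'] by auto
  then have "test_bound S \<beta> \<gamma> (\<lambda>x. a * f x + b * g x) (1 + cmod a * C + cmod b * C')"
    by (intro test_bound_lin[OF C C']) auto
  then show ?thesis by (auto simp: test_space_def)
qed

lemma test_norm_lin:
  assumes f: "f \<in> test_space S \<beta> \<gamma>" and g: "g \<in> test_space S \<beta> \<gamma>"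
  shows "test_norm S \<beta> \<gamma> (\<lambda>x. a * f x + b * g x)
    \<le> cmod a * test_norm S \<beta> \<gamma> f + cmod b * test_norm S \<beta> \<gamma> g"
proof (rule le_of_forall_pos_le_mult)
  fix e :: real assume e: "0 < e"
  let ?p = "test_norm S \<beta> \<gamma>"
  have "test_bound S \<beta> \<gamma> f (?p f + e)" "test_bound S \<beta> \<gamma> g (?p g + e)"
    using e f g by (auto intro: test_bound_of_norm_less)
  moreover have "0 \<le> cmod a * (?p f + e)" "0 \<le> cmod b * (?p g + e)"
    using test_norm_nonneg[OF f] test_norm_nonneg[OF g] e by auto
  ultimately have "test_bound S \<beta> \<gamma> (\<lambda>x. a * f x + b * g x)
      (cmod a * (?p f + e) + cmod b * (?p g + e) + e)"
    using e by (intro test_bound_lin) auto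
  then have "?p (\<lambda>x. a * f x + b * g x) \<le> cmod a * (?p f + e) + cmod b * (?p g + e) + e"
    by (rule test_norm_le)
  then show "?p (\<lambda>x. a * f x + b * g x)
      \<le> cmod a * ?p f + cmod b * ?p g + (cmod a + cmod b + 1) * e"
    by (simp add: algebra_simps)
qed simp

lemma zero_test_space: "(\<lambda>x. 0) \<in> test_space S \<beta> \<gamma>"
  and test_norm_zero: "test_norm S \<beta> \<gamma> (\<lambda>x. 0) = 0"
proof -
  have b: "test_bound S \<beta> \<gamma> (\<lambda>x. 0) C" if "0 < C" for C
    using that by (auto simp: test_bound_def)
  show z: "(\<lambda>x. 0) \<in> test_space S \<beta> \<gamma>"
    unfolding test_space_def by (intro CollectI exI[of _ 1] b) simp
  show "test_norm S \<beta> \<gamma> (\<lambda>x. 0) = 0"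
    using test_norm_lin[OF z z, of 0 0] test_norm_nonneg[OF z] by simp
qed

text \<open>In the range of the regularity condition the quotient of distances is at most 1, and 1 +
  d(x_0,x) is at least 1, so lowering the exponents only enlarges the majorants.\<close>

lemma test_space_mono:
  assumes "\<beta> \<le> \<beta>'" "\<gamma> \<le> \<gamma>'"
  shows "test_space S \<beta>' \<gamma>' \<subseteq> test_space S \<beta> \<gamma>"
proof
  fix f assume "f \<in> test_space S \<beta>' \<gamma>'"
  then obtain C where C: "test_bound S \<beta>' \<gamma>' f C" by (auto simp: test_space_def)
  have decay: "test_decay S \<gamma>' x \<le> test_decay S \<gamma> x" for x
    unfolding test_decay_def using assms
    by (intro mult_left_mono powr_mono) (auto simp: volxy_def)
  have "test_bound S \<beta> \<gamma> f C"
    unfolding test_bound_def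
  proof (intro conjI allI impI test_boundD(1)[OF C])
    fix x
    show "cmod (f x) \<le> C * test_decay S \<gamma> x"
      using test_boundD(2)[OF C, of x] mult_left_mono[OF decay[of x], of C] test_boundD(1)[OF C]
      by linarith
  next
    fix x y assume xy: "d x y \<le> (1 + d (basept S) x) / (2 * A)"
    let ?t = "d x y / (1 + d (basept S) x)"
    have t: "?t \<le> 1" "0 \<le> ?t" using test_ratio_le_1[OF xy] by auto
    have "cmod (f x - f y) \<le> C * (?t powr \<beta>' * test_decay S \<gamma>' x)"
      using test_boundD(3)[OF C xy] by (simp add: mult.assoc)
    also have "\<dots> \<le> C * (?t powr \<beta> * test_decay S \<gamma> x)"
      using test_boundD(1)[OF C] t assms
      by (intro mult_left_mono mult_mono decay powr_mono') auto
    finally show "cmod (f x - f y) \<le> C * ?t powr \<beta> * test_decay S \<gamma> x" by (simp add: mult.assoc)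
  qed
  then show "f \<in> test_space S \<beta> \<gamma>" by (auto simp: test_space_def)
qed

lemma test_space_subset_test_space0:
  assumes "\<beta> \<le> \<eta>" "\<gamma> \<le> \<eta>"
  shows "test_space S \<eta> \<eta> \<subseteq> test_space0 S \<eta> \<beta> \<gamma>"
  using test_space_mono[OF assms] test_norm_zero by (auto simp: test_space0_def intro!: bexI)

lemma seminorm_dense_test_space:
  assumes "\<beta> \<le> \<eta>" "\<gamma> \<le> \<eta>"
  shows "seminorm_dense (test_space0 S \<eta> \<beta> \<gamma>) (test_space S \<eta> \<eta>) (test_norm S \<beta> \<gamma>)"
proof
  let ?p = "test_norm S \<beta> \<gamma>"
  fix \<phi> \<psi> a b assume V: "\<phi> \<in> test_space0 S \<eta> \<beta> \<gamma>" "\<psi> \<in> test_space0 S \<eta> \<beta> \<gamma>"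
  then have T: "\<phi> \<in> test_space S \<beta> \<gamma>" "\<psi> \<in> test_space S \<beta> \<gamma>" by (auto simp: test_space0_def)
  show "?p (\<lambda>x. a * \<phi> x + b * \<psi> x) \<le> cmod a * ?p \<phi> + cmod b * ?p \<psi>"
    using T by (rule test_norm_lin)
  show "(\<lambda>x. a * \<phi> x + b * \<psi> x) \<in> test_space0 S \<eta> \<beta> \<gamma>"
    unfolding test_space0_def
  proof (intro CollectI conjI test_space_lin T allI impI)
    fix e :: real assume e: "0 < e"
    \<comment> \<open>The additional 1 avoids division by 0 and makes the final inequality
      strict.\<close>
    define e' where "e' = e / (cmod a + cmod b + 1)"
    have pos: "0 < cmod a + cmod b + 1" by (simp add: add_nonneg_pos)
    then have e': "0 < e'" using e by (simp add: e'_def)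
    obtain u v where u: "u \<in> test_space S \<eta> \<eta>" "?p (\<lambda>x. \<phi> x - u x) < e'"
      and v: "v \<in> test_space S \<eta> \<eta>" "?p (\<lambda>x. \<psi> x - v x) < e'"
      using V e' unfolding test_space0_def by blast
    have T': "u \<in> test_space S \<beta> \<gamma>" "v \<in> test_space S \<beta> \<gamma>"
      using u(1) v(1) test_space_mono[OF assms] by auto
    have D: "(\<lambda>x. \<phi> x - u x) \<in> test_space S \<beta> \<gamma>" "(\<lambda>x. \<psi> x - v x) \<in> test_space S \<beta> \<gamma>"
      using test_space_lin[OF T(1) T'(1), of 1 "-1"] test_space_lin[OF T(2) T'(2), of 1 "-1"]
      by simp_all
    let ?w = "\<lambda>x. a * u x + b * v x"
    have "(\<lambda>x. (a * \<phi> x + b * \<psi> x) - ?w x) = (\<lambda>x. a * (\<phi> x - u x) + b * (\<psi> x - v x))"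
      by (simp add: algebra_simps)
    then have "?p (\<lambda>x. (a * \<phi> x + b * \<psi> x) - ?w x)
        \<le> cmod a * ?p (\<lambda>x. \<phi> x - u x) + cmod b * ?p (\<lambda>x. \<psi> x - v x)"
      using test_norm_lin[OF D] by simp
    also have "\<dots> \<le> cmod a * e' + cmod b * e'"
      using u(2) v(2) by (intro add_mono mult_left_mono) auto
    also have "\<dots> < (cmod a + cmod b + 1) * e'" using e' by (simp add: distrib_right)
    also have "\<dots> = e" using pos by (simp add: e'_def)
    finally show "\<exists>g\<in>test_space S \<eta> \<eta>. ?p (\<lambda>x. (a * \<phi> x + b * \<psi> x) - g x) < e"
      by (intro bexI[OF _ test_space_lin[OF u(1) v(1)]])
  qed
next
  show "test_space S \<eta> \<eta> \<subseteq> test_space0 S \<eta> \<beta> \<gamma>"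
    using assms by (rule test_space_subset_test_space0)
qed (auto simp: test_space0_def intro: test_space_lin test_norm_nonneg)

section \<open>Test functions measured by the kernel \<open>hker\<close>\<close>

lemma test_bound_le_hker:
  assumes "test_bound S \<beta> \<gamma> \<phi> c"
  shows "cmod (\<phi> x) \<le> c * dblconst S * hker \<gamma> 1 (basept S) x"
proof -
  have "cmod (\<phi> x) \<le> c * test_decay S \<gamma> x" by (rule test_boundD(2)[OF assms])
  also have "\<dots> \<le> c * (dblconst S * hker \<gamma> 1 (basept S) x)"
    using test_boundD(1)[OF assms] by (intro mult_left_mono test_decay_le_hker) auto
  finally show ?thesis by (simp add: mult.assoc)
qed

text \<open>Regularity freed from its restriction to close points. Close points: the exponent drops
  to b because the quotient is at most 1, and the denominator is at least 1. Distant points: 2 A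
  d(x,y) > 1, hence 1 <= 2 A d(x,y)^b as b <= 1, and the two size estimates suffice.\<close>

lemma test_bound_diff_le_hker:
  assumes \<phi>: "test_bound S \<beta> \<gamma> \<phi> c" and b: "0 < b" "b \<le> \<beta>" "b \<le> 1"
  shows "cmod (\<phi> x - \<phi> y) \<le> 2 * A * c * dblconst S * d x y powr b *
    (hker \<gamma> 1 (basept S) x + hker \<gamma> 1 (basept S) y)"
proof -
  let ?H = "hker \<gamma> 1 (basept S)"
  have c: "0 < c" by (rule test_boundD(1)[OF \<phi>])
  have C: "1 \<le> dblconst S" by (rule dblconst_ge_1)
  show ?thesis
  proof (cases "d x y \<le> (1 + d (basept S) x) / (2 * A)")
    case True
    let ?t = "d x y / (1 + d (basept S) x)"
    have t: "?t \<le> 1" "0 \<le> ?t" using test_ratio_le_1[OF True] by auto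
    have "?t powr \<beta> \<le> ?t powr b" using t b by (intro powr_mono') auto
    also have "d x y / (1 + d (basept S) x) \<le> d x y / 1"
      by (intro divide_left_mono) (auto simp: plus_d_pos)
    then have "?t \<le> d x y" by simp
    then have "?t powr b \<le> d x y powr b" using t b by (intro powr_mono2) auto
    finally have tb: "?t powr \<beta> \<le> d x y powr b" .
    have "cmod (\<phi> x - \<phi> y) \<le> c * (?t powr \<beta> * test_decay S \<gamma> x)"
      using test_boundD(3)[OF \<phi> True] by (simp add: mult.assoc)
    also have "\<dots> \<le> c * (d x y powr b * (dblconst S * ?H x))"
      using c by (intro mult_left_mono mult_mono tb test_decay_le_hker) auto
    also have "\<dots> = 1 * (c * dblconst S * d x y powr b * ?H x)" by (simp add: mult_ac)
    also have "\<dots> \<le> (2 * A) * (c * dblconst S * d x y powr b * (?H x + ?H y))"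
      using A_ge_1 c C by (intro mult_mono mult_left_mono) auto
    finally show ?thesis by (simp add: mult_ac)
  next
    case False
    have "1 / (2 * A) \<le> (1 + d (basept S) x) / (2 * A)"
      using A_ge_1 by (intro divide_right_mono) auto
    also have "\<dots> < d x y" using False by simp
    finally have "1 < d x y * (2 * A)" using A_ge_1 by (simp add: pos_divide_less_eq)
    then have "1 \<le> (d x y * (2 * A)) powr b" using b by (intro ge_one_powr_ge_zero) auto
    also have "\<dots> = d x y powr b * (2 * A) powr b" by (rule powr_mult)
    also have "\<dots> \<le> d x y powr b * (2 * A) powr 1"
      using A_ge_1 b by (intro mult_left_mono powr_mono) auto
    finally have one: "1 \<le> d x y powr b * (2 * A)" using A_ge_1 by simp
    have "cmod (\<phi> x - \<phi> y) \<le> cmod (\<phi> x) + cmod (\<phi> y)" by (rule norm_triangle_ineq4)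
    also have "\<dots> \<le> c * dblconst S * ?H x + c * dblconst S * ?H y"
      by (intro add_mono test_bound_le_hker[OF \<phi>])
    also have "\<dots> = 1 * (c * dblconst S * (?H x + ?H y))" by (simp add: algebra_simps)
    also have "\<dots> \<le> (d x y powr b * (2 * A)) * (c * dblconst S * (?H x + ?H y))"
      using c C by (intro mult_right_mono one) auto
    finally show ?thesis by (simp add: mult_ac)
  qed
qed

end

section \<open>Dyadic cubes\<close>

locale dyadic_space = doubling_space S for S :: "('a, 'i) hspace" +
  assumes points: "dyadic_points S" and cubes: "dyadic_cubes S"
begin

abbreviation \<delta> where "\<delta> \<equiv> mesh S"

lemma
  shows mesh_pos: "0 < \<delta>" and mesh_less_1: "\<delta> < 1"
    and sepconst_pos: "0 < sepconst S" and covconst_pos: "0 < covconst S"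
proof -
  note p = points[unfolded dyadic_points_def]
  show "0 < \<delta>" using p by (elim conjE)
  show "\<delta> < 1" using p by (elim conjE)
  show "0 < sepconst S" using p by (elim conjE)
  have "sepconst S \<le> covconst S" using p by (elim conjE)
  with \<open>0 < sepconst S\<close> show "0 < covconst S" by simp
qed

lemma mesh_power: "0 < \<delta> ^ k" "\<delta> ^ k \<le> 1"
  using mesh_pos mesh_less_1 by (auto intro: power_le_one)

lemma
  assumes "\<alpha> \<in> indices S k"
  shows cube_sets: "cube S k \<alpha> \<in> sets \<mu>"
    and qball_subset_cube:
      "qball S (dpoint S k \<alpha>) (sepconst S * \<delta> powi k / (3 * A\<^sup>2)) \<subseteq> cube S k \<alpha>"
    and cube_subset_qball:
      "cube S k \<alpha> \<subseteq> qball S (dpoint S k \<alpha>) (2 * A * covconst S * \<delta> powi k)"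
proof -
  note c = cubes[unfolded dyadic_cubes_def]
  have "\<forall>k. \<forall>\<alpha>\<in>indices S k. cube S k \<alpha> \<in> sets \<mu>" using c by (elim conjE)
  then show "cube S k \<alpha> \<in> sets \<mu>" using assms by blast
  have "\<forall>k. \<forall>\<alpha>\<in>indices S k.
        qball S (dpoint S k \<alpha>) (sepconst S * \<delta> powi k / (3 * A\<^sup>2)) \<subseteq> cube S k \<alpha> \<and>
        cube S k \<alpha> \<subseteq> qball S (dpoint S k \<alpha>) (2 * A * covconst S * \<delta> powi k)"
    using c by (elim conjE)
  then show "qball S (dpoint S k \<alpha>) (sepconst S * \<delta> powi k / (3 * A\<^sup>2)) \<subseteq> cube S k \<alpha>"
    "cube S k \<alpha> \<subseteq> qball S (dpoint S k \<alpha>) (2 * A * covconst S * \<delta> powi k)"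
    using assms by simp_all
qed

lemma cube_disjoint: "disjoint_family_on (cube S k) (indices S k)"
proof -
  have "\<forall>k. disjoint_family_on (cube S k) (indices S k)"
    using cubes unfolding dyadic_cubes_def by (elim conjE)
  then show ?thesis by blast
qed

lemma dpoint_in_cube:
  assumes "\<alpha> \<in> indices S k"
  shows "dpoint S k \<alpha> \<in> cube S k \<alpha>"
proof -
  have "0 < sepconst S * \<delta> powi k / (3 * A\<^sup>2)"
    using sepconst_pos mesh_pos A_ge_1 by (intro divide_pos_pos mult_pos_pos) auto
  then have "dpoint S k \<alpha> \<in> qball S (dpoint S k \<alpha>) (sepconst S * \<delta> powi k / (3 * A\<^sup>2))"
    by (simp add: qball_def d_eq_0[THEN iffD2])
  then show ?thesis using qball_subset_cube[OF assms] by blast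
qed

lemma cube_diam:
  assumes "\<alpha> \<in> indices S k" "u \<in> cube S k \<alpha>" "v \<in> cube S k \<alpha>"
  shows "d u v \<le> 4 * A\<^sup>2 * covconst S * \<delta> powi k"
proof -
  let ?z = "dpoint S k \<alpha>"
  have "d ?z u < 2 * A * covconst S * \<delta> powi k" "d ?z v < 2 * A * covconst S * \<delta> powi k"
    using cube_subset_qball[OF assms(1)] assms by (auto simp: qball_def)
  then have "d u ?z + d ?z v \<le> 4 * A * covconst S * \<delta> powi k"
    by (simp add: d_commute[of u])
  then have "A * (d u ?z + d ?z v) \<le> A * (4 * A * covconst S * \<delta> powi k)"
    using A_ge_1 by (intro mult_left_mono) auto
  then show ?thesis
    using d_triangle[of u v ?z] by (simp add: power2_eq_square mult_ac)
qed

lemma subidxD: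
  assumes "\<tau> \<in> subidx S k \<alpha>"
  shows "\<tau> \<in> indices S (int (k + subgap S))" "subcube S k \<tau> \<subseteq> cube S (int k) \<alpha>"
    "subcube S k \<tau> \<in> sets \<mu>" "dpoint S (int (k + subgap S)) \<tau> \<in> subcube S k \<tau>"
  using assms cube_sets[of \<tau> "int (k + subgap S)"] dpoint_in_cube[of \<tau> "int (k + subgap S)"]
  by (auto simp: subidx_def subcube_def)

text \<open>Diameter in units of the mesh of the level: twice the outer radius 2 A C_0, times A from
  the quasi-triangle inequality.\<close>

definition diamc :: real where "diamc = 4 * A\<^sup>2 * covconst S"

lemma diamc_nonneg: "0 \<le> diamc"
  using covconst_pos by (simp add: diamc_def)

lemma subcube_diam:
  assumes "\<tau> \<in> subidx S k \<alpha>" "u \<in> subcube S k \<tau>" "v \<in> subcube S k \<tau>"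
  shows "d u v \<le> diamc * \<delta> ^ k"
proof -
  have "d u v \<le> diamc * \<delta> powi int (k + subgap S)"
    using cube_diam[OF subidxD(1)[OF assms(1)]] assms by (simp add: subcube_def diamc_def)
  also have "\<dots> = diamc * (\<delta> ^ k * \<delta> ^ subgap S)"
    by (simp only: power_int_of_nat power_add)
  also have "\<dots> \<le> diamc * (\<delta> ^ k * 1)"
    using mesh_power diamc_nonneg by (intro mult_left_mono) (auto simp: less_imp_le)
  finally show ?thesis by simp
qed

definition subpairs :: "nat \<Rightarrow> ('i \<times> 'i) set" where
  "subpairs k = (SIGMA \<alpha>:indices S (int k). subidx S k \<alpha>)"

text \<open>Pairs with different parents are separated by the parents, pairs with the same parent by
  the cubes of the finer level.\<close>

lemma subpairs_disjoint: "disjoint_family_on (\<lambda>p. subcube S k (snd p)) (subpairs k)"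
proof (unfold disjoint_family_on_def, intro ballI impI)
  fix p p' assume p: "p \<in> subpairs k" "p' \<in> subpairs k" "p \<noteq> p'"
  obtain \<alpha> \<tau> \<alpha>' \<tau>' where eq: "p = (\<alpha>, \<tau>)" "p' = (\<alpha>', \<tau>')" by (metis surj_pair)
  then have mem: "\<alpha> \<in> indices S (int k)" "\<alpha>' \<in> indices S (int k)"
    "\<tau> \<in> subidx S k \<alpha>" "\<tau>' \<in> subidx S k \<alpha>'"
    using p by (auto simp: subpairs_def)
  show "subcube S k (snd p) \<inter> subcube S k (snd p') = {}"
  proof (cases "\<alpha> = \<alpha>'")
    case True
    then have "\<tau> \<noteq> \<tau>'" using p(3) eq by simp
    then show ?thesis
      using cube_disjoint[of "int (k + subgap S)"] subidxD(1)[OF mem(3)] subidxD(1)[OF mem(4)] eq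
      by (simp add: disjoint_family_on_def subcube_def)
  next
    case False
    then have "cube S (int k) \<alpha> \<inter> cube S (int k) \<alpha>' = {}"
      using cube_disjoint[of "int k"] mem by (simp add: disjoint_family_on_def)
    then show ?thesis using subidxD(2)[OF mem(3)] subidxD(2)[OF mem(4)] eq by auto
  qed
qed

section \<open>Measures of cubes and subcubes\<close>

lemma emeasure_cube_finite: "\<alpha> \<in> indices S k \<Longrightarrow> emeasure \<mu> (cube S k \<alpha>) < \<infinity>"
  using emeasure_mono[OF cube_subset_qball[of \<alpha> k] qball_sets] emeasure_qball_lt_top
    le_less_trans by blast

lemma emeasure_cube_pos:
  assumes "\<alpha> \<in> indices S k"
  shows "0 < emeasure \<mu> (cube S k \<alpha>)"
proof -
  have "0 < sepconst S * \<delta> powi k / (3 * A\<^sup>2)"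
    using sepconst_pos mesh_pos A_ge_1 by (intro divide_pos_pos mult_pos_pos) auto
  then have "0 < emeasure \<mu> (qball S (dpoint S k \<alpha>) (sepconst S * \<delta> powi k / (3 * A\<^sup>2)))"
    by (rule emeasure_qball_pos)
  also have "\<dots> \<le> emeasure \<mu> (cube S k \<alpha>)"
    by (intro emeasure_mono qball_subset_cube cube_sets assms)
  finally show ?thesis .
qed

lemma subcube_emeasure:
  assumes "\<tau> \<in> subidx S k \<alpha>"
  shows "0 < emeasure \<mu> (subcube S k \<tau>)" "emeasure \<mu> (subcube S k \<tau>) < \<infinity>"
    "emeasure \<mu> (subcube S k \<tau>) = ennreal (measure \<mu> (subcube S k \<tau>))"
proof -
  show 1: "0 < emeasure \<mu> (subcube S k \<tau>)" "emeasure \<mu> (subcube S k \<tau>) < \<infinity>"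
    using emeasure_cube_pos[OF subidxD(1)[OF assms]] emeasure_cube_finite[OF subidxD(1)[OF assms]]
    by (simp_all add: subcube_def)
  show "emeasure \<mu> (subcube S k \<tau>) = ennreal (measure \<mu> (subcube S k \<tau>))"
    using 1 by (intro emeasure_eq_ennreal_measure) auto
qed

text \<open>Around the centre of the subcube, an outer ball containing the cube and an inner ball
  contained in the subcube have radii in a ratio independent of the level, since the gap between the
  levels is fixed; doubling compares their volumes.\<close>

lemma cube_le_subcube:
  obtains K where "1 \<le> K" "\<And>k \<alpha> \<tau>. \<alpha> \<in> indices S (int k) \<Longrightarrow> \<tau> \<in> subidx S k \<alpha> \<Longrightarrow>
    emeasure \<mu> (cube S (int k) \<alpha>) \<le> ennreal K * emeasure \<mu> (subcube S k \<tau>)"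
proof -
  \<comment> \<open>At level k the inner ball of a subcube has radius c times the k-th power of the
    mesh.\<close>
  define c where "c = sepconst S * \<delta> ^ subgap S / (3 * A\<^sup>2)"
  have c: "0 < c"
    unfolding c_def using sepconst_pos mesh_pos A_ge_1 by (intro divide_pos_pos mult_pos_pos) auto
  \<comment> \<open>The 1 added to \<open>diamc\<close> yields the strict inequality in the
    definition of a ball.\<close>
  obtain K where K: "1 \<le> K" "\<And>r x. 0 < r \<Longrightarrow> vol S ((diamc + 1) / c * r) x \<le> K * vol S r x"
    using vol_dilate[of "(diamc + 1) / c"] by blast
  show ?thesis
  proof (rule that[OF K(1)])
    fix k \<alpha> \<tau> assume \<alpha>: "\<alpha> \<in> indices S (int k)" and \<tau>: "\<tau> \<in> subidx S k \<alpha>"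
    let ?z = "dpoint S (int (k + subgap S)) \<tau>"
    let ?r = "c * \<delta> ^ k"
    have r: "0 < ?r" using c mesh_power by simp
    have z: "?z \<in> cube S (int k) \<alpha>" using subidxD(2,4)[OF \<tau>] by blast
    have "cube S (int k) \<alpha> \<subseteq> qball S ?z ((diamc + 1) / c * ?r)"
    proof
      fix u assume "u \<in> cube S (int k) \<alpha>"
      then have "d ?z u \<le> diamc * \<delta> ^ k" using cube_diam[OF \<alpha> z] by (simp add: diamc_def)
      also have "\<dots> < (diamc + 1) * \<delta> ^ k" using mesh_pos by simp
      also have "\<dots> = (diamc + 1) / c * ?r" using c by simp
      finally show "u \<in> qball S ?z ((diamc + 1) / c * ?r)" by (simp add: qball_def)
    qed
    then have "emeasure \<mu> (cube S (int k) \<alpha>) \<le> emeasure \<mu> (qball S ?z ((diamc + 1) / c * ?r))"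
      by (intro emeasure_mono) auto
    also have "\<dots> \<le> ennreal (K * vol S ?r ?z)"
      unfolding emeasure_qball using K(2)[OF r] by (intro ennreal_leI) auto
    also have "\<dots> = ennreal K * emeasure \<mu> (qball S ?z ?r)"
      using K(1) by (simp add: emeasure_qball ennreal_mult)
    also have "\<dots> \<le> ennreal K * emeasure \<mu> (subcube S k \<tau>)"
    proof (intro mult_left_mono emeasure_mono subidxD(3)[OF \<tau>])
      have "?r = sepconst S * \<delta> powi (int (k + subgap S)) / (3 * A\<^sup>2)"
        unfolding power_int_of_nat by (simp add: c_def power_add mult_ac)
      then show "qball S ?z ?r \<subseteq> subcube S k \<tau>"
        using qball_subset_cube[OF subidxD(1)[OF \<tau>]] by (simp only: subcube_def)
    qed simp
    finally show "emeasure \<mu> (cube S (int k) \<alpha>) \<le> ennreal K * emeasure \<mu> (subcube S k \<tau>)" .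
  qed
qed

section \<open>Consequences of a finite Triebel--Lizorkin norm\<close>

lemma F_local_le_F_norm:
  assumes "N < l" "\<alpha> \<in> indices S (int l)"
  shows "F_local S Q s q f l \<alpha> \<le> F_norm S Q N s q f"
proof -
  have "F_local S Q s q f l \<alpha>
      \<le> (SUP l\<in>{N<..}. SUP \<alpha>\<in>indices S (int l). F_local S Q s q f l \<alpha>)"
    using assms by (intro SUP_upper2[of l] SUP_upper2[of \<alpha>]) auto
  then show ?thesis by (simp add: F_norm_def le_max_iff_disj)
qed

lemma mean_le_F_norm:
  assumes "k \<le> N" "\<alpha> \<in> indices S (int k)" "\<tau> \<in> subidx S k \<alpha>"
    and M: "F_norm S Q N s q f \<le> ennreal M" "0 \<le> M"
  shows "cmod (mean S (subcube S k \<tau>) (Qf Q f k)) \<le> M"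
proof -
  let ?E = "subcube S k \<tau>"
  let ?I = "\<integral>\<^sup>+x\<in>?E. ennreal (cmod (Qf Q f k x)) \<partial>\<mu>"
  have pos: "0 < measure \<mu> ?E"
    using subcube_emeasure(1)[OF assms(3)] by (simp add: subcube_emeasure(3)[OF assms(3)])
  have "?I / emeasure \<mu> ?E \<le> (SUP k\<in>{..N}. SUP \<alpha>\<in>indices S (int k). SUP \<tau>\<in>subidx S k \<alpha>.
          (\<integral>\<^sup>+x\<in>subcube S k \<tau>. ennreal (cmod (Qf Q f k x)) \<partial>\<mu>) / emeasure \<mu> (subcube S k \<tau>))"
    using assms by (intro SUP_upper2[of k] SUP_upper2[of \<alpha>] SUP_upper2[of \<tau>]) auto
  also have "\<dots> \<le> ennreal M" using M(1) by (simp add: F_norm_def)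
  finally have "?I / emeasure \<mu> ?E \<le> ennreal M" .
  then have "?I \<le> ennreal M * emeasure \<mu> ?E"
    using subcube_emeasure(1,2)[OF assms(3)] by (intro ennreal_divide_leD) auto
  then have I: "?I \<le> ennreal (M * measure \<mu> ?E)"
    using M(2) by (simp add: subcube_emeasure(3)[OF assms(3)] ennreal_mult)
  have "ennreal (cmod (LINT x:?E|\<mu>. Qf Q f k x)) \<le> ?I"
    by (rule norm_set_lebesgue_integral_le)
  then have "ennreal (cmod (LINT x:?E|\<mu>. Qf Q f k x)) \<le> ennreal (M * measure \<mu> ?E)"
    using I by (rule order_trans)
  then have "cmod (LINT x:?E|\<mu>. Qf Q f k x) \<le> M * measure \<mu> ?E"
    using M(2) by (subst (asm) ennreal_le_iff) auto
  then show ?thesis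
    using pos by (simp add: mean_def norm_divide pos_divide_le_eq)
qed

text \<open>\<open>F_local\<close> is used for the cube of level k itself, and of its sum or
  supremum over the levels only the first entry, that of level k, is kept.\<close>

lemma F_norm_sample_point:
  assumes q: "0 < q"
  obtains K where "0 < K"
    "\<And>N k \<alpha> \<tau> Q f M. N < k \<Longrightarrow> \<alpha> \<in> indices S (int k) \<Longrightarrow> \<tau> \<in> subidx S k \<alpha> \<Longrightarrow>
      F_norm S Q N s q f \<le> ennreal M \<Longrightarrow> 0 < M \<Longrightarrow>
      \<exists>u\<in>subcube S k \<tau>. cmod (Qf Q f k u) \<le> K * M * \<delta> powr (real k * s)"
proof (cases "q = \<infinity>")
  case True
  show ?thesis
  proof (rule that[of 1])
    fix N k \<alpha> \<tau> M and Q :: "nat \<Rightarrow> 'a \<Rightarrow> 'a \<Rightarrow> complex" and f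
    assume k: "N < k" "\<alpha> \<in> indices S (int k)" "\<tau> \<in> subidx S k \<alpha>"
      and F: "F_norm S Q N s q f \<le> ennreal M" and M: "0 < M"
    let ?R = "restrict_space \<mu> (cube S (int k) \<alpha>)"
    let ?g = "\<lambda>x. SUP j\<in>{k..}. ennreal (\<delta> powr (- (real j * s)) * cmod (Qf Q f j x))"
    have "esssup ?R ?g \<le> ennreal M"
      using F_local_le_F_norm[OF k(1,2), of Q s q f] F True by (simp add: F_local_def)
    moreover have "AE x in ?R. ?g x \<le> esssup ?R ?g" by (rule esssup_AE)
    ultimately have "AE x in ?R. ?g x \<le> ennreal M"
      by (auto elim: eventually_mono)
    moreover have "cube S (int k) \<alpha> \<inter> space \<mu> \<in> sets \<mu>" using cube_sets[OF k(2)] by simp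
    ultimately have AE: "AE x in \<mu>. x \<in> cube S (int k) \<alpha> \<longrightarrow> ?g x \<le> ennreal M"
      by (simp add: AE_restrict_space_iff)
    \<comment> \<open>A bound almost everywhere on the cube holds somewhere on the subcube, which
      has positive measure.\<close>
    have "\<exists>u\<in>subcube S k \<tau>. ?g u \<le> ennreal M"
    proof (rule ccontr)
      assume "\<not> ?thesis"
      then have "AE x in \<mu>. x \<notin> subcube S k \<tau>"
        using AE subidxD(2)[OF k(3)] by (auto elim!: eventually_mono)
      then have "subcube S k \<tau> \<in> null_sets \<mu>"
        using AE_iff_null_sets[OF subidxD(3)[OF k(3)]] by simp
      then show False using subcube_emeasure(1)[OF k(3)] by (simp add: null_sets_def)
    qed
    then obtain u where u: "u \<in> subcube S k \<tau>" "?g u \<le> ennreal M" by blast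
    have "ennreal (\<delta> powr (- (real k * s)) * cmod (Qf Q f k u)) \<le> ?g u"
      by (rule SUP_upper) simp
    then have "ennreal (\<delta> powr (- (real k * s)) * cmod (Qf Q f k u)) \<le> ennreal M"
      using u(2) by (rule order_trans)
    then have "\<delta> powr (- (real k * s)) * cmod (Qf Q f k u) \<le> M"
      using M by (subst (asm) ennreal_le_iff) auto
    then have "\<delta> powr (real k * s) * (\<delta> powr (- (real k * s)) * cmod (Qf Q f k u))
        \<le> \<delta> powr (real k * s) * M"
      by (rule mult_left_mono) simp
    then have "cmod (Qf Q f k u) \<le> M * \<delta> powr (real k * s)"
      using mesh_pos by (simp add: mult.assoc[symmetric] powr_add[symmetric] mult.commute[of M])
    then show "\<exists>u\<in>subcube S k \<tau>. cmod (Qf Q f k u) \<le> 1 * M * \<delta> powr (real k * s)"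
      using u(1) by auto
  qed simp
next
  case False
  define p where "p = enn2real q"
  have p: "0 < p" using q False unfolding p_def by (simp add: enn2real_positive_iff less_top)
  obtain L where L: "1 \<le> L" "\<And>k \<alpha> \<tau>. \<alpha> \<in> indices S (int k) \<Longrightarrow> \<tau> \<in> subidx S k \<alpha> \<Longrightarrow>
    emeasure \<mu> (cube S (int k) \<alpha>) \<le> ennreal L * emeasure \<mu> (subcube S k \<tau>)"
    using cube_le_subcube by blast
  \<comment> \<open>If every value on the subcube exceeded the claimed bound, the integral over the
    cube would be at least 2 L M^p times the measure of the subcube, while \<open>L\<close> permits
    only half of that.\<close>
  define K where "K = (2 * L) powr (1 / p)"
  have K: "0 < K" "K powr p = 2 * L" using L(1) p by (auto simp: K_def powr_powr)
  show ?thesis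
  proof (rule that[OF K(1)])
    fix N k \<alpha> \<tau> M and Q :: "nat \<Rightarrow> 'a \<Rightarrow> 'a \<Rightarrow> complex" and f
    assume k: "N < k" "\<alpha> \<in> indices S (int k)" "\<tau> \<in> subidx S k \<alpha>"
      and F: "F_norm S Q N s q f \<le> ennreal M" and M: "0 < M"
    let ?Q = "cube S (int k) \<alpha>" and ?E = "subcube S k \<tau>"
    let ?g = "\<lambda>x. \<Sum>i. ennreal (\<delta> powr (- (real (k + i) * s * p)) * cmod (Qf Q f (k + i) x) powr p)"
    have "enn_powr ((\<integral>\<^sup>+x\<in>?Q. ?g x \<partial>\<mu>) / emeasure \<mu> ?Q) (1 / p) \<le> ennreal M"
      using F_local_le_F_norm[OF k(1,2), of Q s q f] F False by (simp add: F_local_def p_def)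
    then have "(\<integral>\<^sup>+x\<in>?Q. ?g x \<partial>\<mu>) / emeasure \<mu> ?Q \<le> ennreal (M powr p)"
      using p M by (rule enn_powr_leD)
    then have I: "(\<integral>\<^sup>+x\<in>?Q. ?g x \<partial>\<mu>) \<le> ennreal (M powr p) * emeasure \<mu> ?Q"
      using emeasure_cube_pos[OF k(2)] emeasure_cube_finite[OF k(2)]
      by (intro ennreal_divide_leD) auto
    show "\<exists>u\<in>?E. cmod (Qf Q f k u) \<le> K * M * \<delta> powr (real k * s)"
    proof (rule ccontr)
      assume "\<not> ?thesis"
      then have gt: "K * M * \<delta> powr (real k * s) < cmod (Qf Q f k u)" if "u \<in> ?E" for u
        using that by (auto simp: not_le)
      have lower: "ennreal (2 * L * M powr p) \<le> ?g u" if "u \<in> ?E" for u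
      proof -
        have "(K * M * \<delta> powr (real k * s)) powr p = 2 * L * M powr p * \<delta> powr (real k * s * p)"
          by (simp only: powr_mult K(2) powr_powr)
        moreover have "\<delta> powr (- (real k * s * p)) * \<delta> powr (real k * s * p) = 1"
          using mesh_pos by (simp add: powr_add[symmetric])
        ultimately have "2 * L * M powr p
            = \<delta> powr (- (real k * s * p)) * (K * M * \<delta> powr (real k * s)) powr p"
          by (simp only: mult.left_commute)
        also have "\<dots> \<le> \<delta> powr (- (real k * s * p)) * cmod (Qf Q f k u) powr p"
          using gt[OF that] K M p by (intro mult_left_mono powr_mono2) auto
        finally have "ennreal (2 * L * M powr p)
            \<le> ennreal (\<delta> powr (- (real (k + 0) * s * p)) * cmod (Qf Q f (k + 0) u) powr p)"
          by (simp add: ennreal_leI)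
        also have "\<dots> = (\<Sum>i\<in>{0}. ennreal (\<delta> powr (- (real (k + i) * s * p))
            * cmod (Qf Q f (k + i) u) powr p))"
          by simp
        also have "\<dots> \<le> ?g u" by (rule sum_le_suminf) auto
        finally show ?thesis .
      qed
      \<comment> \<open>Here an integral is bounded from below; a constant on the subcube is a
        measurable minorant, so nothing is asked of \<open>?g\<close>.\<close>
      have "ennreal (2 * L * M powr p) * emeasure \<mu> ?E
          = (\<integral>\<^sup>+x. ennreal (2 * L * M powr p) * indicator ?E x \<partial>\<mu>)"
        using subidxD(3)[OF k(3)] by (simp add: nn_integral_cmult_indicator)
      also have "\<dots> \<le> (\<integral>\<^sup>+x\<in>?Q. ?g x \<partial>\<mu>)"
      proof (rule nn_integral_mono)
        fix x
        show "ennreal (2 * L * M powr p) * indicator ?E x \<le> ?g x * indicator ?Q x"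
        proof (cases "x \<in> ?E")
          case True
          then have "x \<in> ?Q" using subidxD(2)[OF k(3)] by blast
          then show ?thesis using lower[OF True] True by (simp only: indicator_simps mult_1_right)
        next
          case False
          then have "indicator ?E x = (0 :: ennreal)" by simp
          then show ?thesis by (simp only: mult_zero_right zero_le)
        qed
      qed
      also have "\<dots> \<le> ennreal (M powr p) * (ennreal L * emeasure \<mu> ?E)"
        by (rule order_trans[OF I]) (intro mult_left_mono L(2) k, simp)
      finally have "ennreal (2 * L * M powr p * measure \<mu> ?E) \<le> ennreal (L * M powr p * measure \<mu> ?E)"
        using L(1) by (simp add: subcube_emeasure(3)[OF k(3)] ennreal_mult mult_ac)
      then have "2 * L * M powr p * measure \<mu> ?E \<le> L * M powr p * measure \<mu> ?E"
        using L(1) by (subst (asm) ennreal_le_iff) auto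
      moreover have "0 < measure \<mu> ?E"
        using subcube_emeasure(1)[OF k(3)] by (simp add: subcube_emeasure(3)[OF k(3)])
      then have "0 < L * M powr p * measure \<mu> ?E" using L(1) M by simp
      ultimately show False by simp
    qed
  qed
qed

end

section \<open>Pairing with test functions\<close>

context dyadic_space
begin

text \<open>One majorant for all levels, with the integrand of \<open>two_hker_sum\<close>: the
  weight at \<open>x\<close> bounds the test function itself, the weight at \<open>y\<close> the
  value subtracted by cancellation.\<close>

definition pairing :: "real \<Rightarrow> real \<Rightarrow> real \<Rightarrow> 'a \<Rightarrow> ennreal" where
  "pairing g g' r y =
     (\<integral>\<^sup>+x. ennreal (hker g r y x * (hker g' 1 (basept S) x + hker g' 1 (basept S) y)) \<partial>\<mu>)"

lemma norm_integral_le_pairing: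
  fixes G :: "'a \<Rightarrow> complex"
  assumes "\<And>x. cmod (G x) \<le> B * (hker g r y x * (hker g' 1 (basept S) x + hker g' 1 (basept S) y))"
    and "0 \<le> B"
  shows "ennreal (cmod (integral\<^sup>L \<mu> G)) \<le> ennreal B * pairing g g' r y"
proof -
  have "ennreal (cmod (integral\<^sup>L \<mu> G)) \<le> (\<integral>\<^sup>+x. ennreal (cmod (G x)) \<partial>\<mu>)"
    by (rule norm_lebesgue_integral_le)
  also have "\<dots> \<le> (\<integral>\<^sup>+x. ennreal B *
      ennreal (hker g r y x * (hker g' 1 (basept S) x + hker g' 1 (basept S) y)) \<partial>\<mu>)"
  proof (rule nn_integral_mono)
    fix x
    show "ennreal (cmod (G x)) \<le> ennreal B *
        ennreal (hker g r y x * (hker g' 1 (basept S) x + hker g' 1 (basept S) y))"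
      using ennreal_leI[OF assms(1)[of x]] assms(2) by (simp only: ennreal_mult')
  qed
  also have "\<dots> = ennreal B * pairing g g' r y"
    unfolding pairing_def by (intro nn_integral_cmult) measurable
  finally show ?thesis .
qed

text \<open>For kernels without cancellation. The estimate is weakened on purpose, to the exponent
  gamma - b and with the extra weight at \<open>y\<close>, so that it has the same shape as
  \<open>pairing_cancellation\<close>.\<close>

lemma pairing_size:
  assumes \<phi>: "test_bound S \<beta>' \<gamma>' \<phi> c"
    and K: "\<And>x. cmod (K x) \<le> C * hker \<gamma> r y x"
    and C: "0 \<le> C" and r: "0 < r" and b: "0 \<le> b"
  shows "ennreal (cmod (\<integral>x. K x * \<phi> x \<partial>\<mu>))
    \<le> ennreal (2 * A * dblconst S * C * c) * pairing (\<gamma> - b) \<gamma>' r y"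
proof (rule norm_integral_le_pairing)
  have c: "0 < c" by (rule test_boundD(1)[OF \<phi>])
  show "0 \<le> 2 * A * dblconst S * C * c" using A_ge_1 dblconst_ge_1 C c by simp
  fix x
  let ?H = "hker \<gamma>' 1 (basept S)"
  have "cmod (K x * \<phi> x) \<le> (C * hker \<gamma> r y x) * (c * dblconst S * ?H x)"
    unfolding norm_mult using C by (intro mult_mono K test_bound_le_hker[OF \<phi>]) auto
  also have "\<dots> \<le> (C * hker (\<gamma> - b) r y x) * (c * dblconst S * (?H x + ?H y))"
    using C c dblconst_ge_1 b r by (intro mult_mono mult_left_mono hker_antimono) auto
  also have "\<dots> = 1 * (C * hker (\<gamma> - b) r y x * (c * dblconst S * (?H x + ?H y)))" by simp
  also have "\<dots> \<le> (2 * A) * (C * hker (\<gamma> - b) r y x * (c * dblconst S * (?H x + ?H y)))"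
    using A_ge_1 C c dblconst_ge_1 by (intro mult_right_mono) auto
  finally show "cmod (K x * \<phi> x)
      \<le> 2 * A * dblconst S * C * c * (hker (\<gamma> - b) r y x * (?H x + ?H y))"
    by (simp only: mult_ac)
qed

text \<open>As \<open>K\<close> has integral 0, the value of the test function at \<open>y\<close>
  may be subtracted from it. Splitting the integral needs the product to be integrable; otherwise
  the left-hand side is 0.\<close>

lemma pairing_cancellation:
  assumes \<phi>: "test_bound S \<beta>' \<gamma>' \<phi> c"
    and K: "\<And>x. cmod (K x) \<le> C * hker \<gamma> r y x"
    and int: "integrable \<mu> K" "integral\<^sup>L \<mu> K = 0"
    and C: "0 \<le> C" and r: "0 < r" and b: "0 < b" "b \<le> \<beta>'" "b \<le> 1"
  shows "ennreal (cmod (\<integral>x. K x * \<phi> x \<partial>\<mu>))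
    \<le> ennreal (2 * A * dblconst S * C * c * r powr b) * pairing (\<gamma> - b) \<gamma>' r y"
proof (cases "integrable \<mu> (\<lambda>x. K x * \<phi> x)")
  case True
  let ?H = "hker \<gamma>' 1 (basept S)"
  have c: "0 < c" by (rule test_boundD(1)[OF \<phi>])
  have "(\<integral>x. K x * \<phi> x \<partial>\<mu>) = (\<integral>x. K x * \<phi> x \<partial>\<mu>) - (\<integral>x. K x * \<phi> y \<partial>\<mu>)"
    using int by simp
  also have "\<dots> = (\<integral>x. K x * \<phi> x - K x * \<phi> y \<partial>\<mu>)"
    using True int by (intro Bochner_Integration.integral_diff[symmetric]) auto
  also have "ennreal (cmod \<dots>)
      \<le> ennreal (2 * A * dblconst S * C * c * r powr b) * pairing (\<gamma> - b) \<gamma>' r y"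
  proof (rule norm_integral_le_pairing)
    show "0 \<le> 2 * A * dblconst S * C * c * r powr b" using A_ge_1 dblconst_ge_1 C c by simp
    fix x
    have "cmod (K x * \<phi> x - K x * \<phi> y) = cmod (K x) * cmod (\<phi> x - \<phi> y)"
      by (simp add: norm_mult[symmetric] right_diff_distrib)
    also have "\<dots> \<le> (C * hker \<gamma> r y x)
        * (2 * A * c * dblconst S * d x y powr b * (?H x + ?H y))"
      using C by (intro mult_mono K test_bound_diff_le_hker[OF \<phi> b]) auto
    also have "\<dots> = 2 * A * c * dblconst S * C * (?H x + ?H y) * (hker \<gamma> r y x * d y x powr b)"
      by (simp only: mult_ac d_commute[of x y])
    also have "\<dots> \<le> 2 * A * c * dblconst S * C * (?H x + ?H y)
        * (r powr b * hker (\<gamma> - b) r y x)"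
      using A_ge_1 dblconst_ge_1 C c r b
      by (intro mult_left_mono[OF hker_mult_powr]) auto
    finally show "cmod (K x * \<phi> x - K x * \<phi> y)
        \<le> 2 * A * dblconst S * C * c * r powr b * (hker (\<gamma> - b) r y x * (?H x + ?H y))"
      by (simp only: mult_ac)
  qed
  finally show ?thesis .
qed (simp add: not_integrable_integral_eq)

lemma norm_set_integral_le_bound:
  assumes E: "E \<in> sets \<mu>" "emeasure \<mu> E = ennreal m" "0 \<le> m"
    and K: "\<And>u. u \<in> E \<Longrightarrow> cmod (K u) \<le> B" and B: "0 \<le> B"
  shows "cmod (LINT u:E|\<mu>. K u) \<le> B * m"
proof -
  have "ennreal (cmod (LINT u:E|\<mu>. K u)) \<le> (\<integral>\<^sup>+u\<in>E. ennreal (cmod (K u)) \<partial>\<mu>)"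
    by (rule norm_set_lebesgue_integral_le)
  also have "\<dots> \<le> (\<integral>\<^sup>+u. ennreal B * indicator E u \<partial>\<mu>)"
    using K by (intro nn_integral_mono) (auto simp: indicator_def intro: ennreal_leI)
  also have "\<dots> = ennreal (B * m)"
    using E B by (simp add: nn_integral_cmult_indicator ennreal_mult)
  finally show ?thesis using E(3) B by (subst (asm) ennreal_le_iff) auto
qed

text \<open>\<open>c\<close> and \<open>M\<close> are arbitrary upper bounds in place of norms: the
  norm of a test function is an infimum, and the choice of sample points needs a positive
  \<open>M\<close>.\<close>

lemma reproducing_estimate:
  assumes rep: "reproducing S \<eta> Q N"
    and par: "0 < \<beta>" "\<beta> < \<eta>" "0 < \<gamma>" "\<gamma> < \<eta>" "0 < \<gamma>'" "0 < q"
    and b: "0 < b" "- s < b" "b \<le> \<beta>'" "b < \<gamma>" "b \<le> 1"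
  obtains K where "0 < K"
    "\<And>f \<phi> c M. f \<in> dual S \<eta> \<beta> \<gamma> \<Longrightarrow> \<phi> \<in> test_space0 S \<eta> \<beta> \<gamma> \<Longrightarrow>
      test_bound S \<beta>' \<gamma>' \<phi> c \<Longrightarrow> F_norm S Q N s q f \<le> ennreal M \<Longrightarrow> 0 < M \<Longrightarrow>
      cmod (f \<phi>) \<le> K * c * M"
proof -
  obtain C where C: "0 < C" and Qt: "\<And>y.
    (\<forall>k. \<forall>\<alpha>\<in>indices S (int k). \<forall>\<tau>\<in>subidx S k \<alpha>. y k \<alpha> \<tau> \<in> subcube S k \<tau>) \<Longrightarrow>
    \<exists>Qt. (\<forall>k u v. cmod (Qt k u v) \<le> C * poly_bound S \<gamma> k u v) \<and>
      (\<forall>k. marginals S (Qt k) (if k \<le> N then 1 else 0)) \<and>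
      (\<forall>f\<in>dual S \<eta> \<beta> \<gamma>. \<forall>\<phi>\<in>test_space0 S \<eta> \<beta> \<gamma>.
        \<exists>t. (\<forall>k. ((\<lambda>(\<alpha>, \<tau>). repr_term S Q N y Qt f \<phi> k \<alpha> \<tau>) has_sum t k) (subpairs k)) \<and>
            t sums f \<phi>)"
  proof -
    note H = rep[unfolded reproducing_def, THEN conjunct2, rule_format, OF par(1-4),
        folded subpairs_def]
    show thesis
      by (insert H, elim exE conjE, rule that, assumption, drule spec, drule (1) mp,
          elim exE conjE, intro exI conjI; assumption)
  qed
  obtain K0 where K0: "1 \<le> K0" "\<And>g r x y. 0 < r \<Longrightarrow> hker g r x y \<le> K0 * hker g r y x"
    using hker_commute_le by blast
  obtain K2 where K2: "1 \<le> K2"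
    "\<And>r x y u. 0 < r \<Longrightarrow> d u y \<le> diamc * r \<Longrightarrow> hker \<gamma> r x y \<le> K2 * hker \<gamma> r x u"
    using hker_shift[OF diamc_nonneg less_imp_le[OF par(3)]] by blast
  obtain K3 where K3: "0 < K3"
    "\<And>N k \<alpha> \<tau> Q f M. N < k \<Longrightarrow> \<alpha> \<in> indices S (int k) \<Longrightarrow> \<tau> \<in> subidx S k \<alpha> \<Longrightarrow>
      F_norm S Q N s q f \<le> ennreal M \<Longrightarrow> 0 < M \<Longrightarrow>
      \<exists>u\<in>subcube S k \<tau>. cmod (Qf Q f k u) \<le> K3 * M * \<delta> powr (real k * s)"
    using F_norm_sample_point[OF par(6)] by blast
  have gb: "0 < \<gamma> - b" using b by simp
  obtain K4 where K4: "0 < K4"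
    "\<And>(P :: ('i \<times> 'i) set) E y r x\<^sub>0.
      0 < r \<Longrightarrow> r \<le> 1 \<Longrightarrow> finite P \<Longrightarrow> disjoint_family_on E P \<Longrightarrow>
      (\<And>p. p \<in> P \<Longrightarrow> E p \<in> sets \<mu>) \<Longrightarrow>
      (\<And>p u. p \<in> P \<Longrightarrow> u \<in> E p \<Longrightarrow> d u (y p) \<le> diamc * r) \<Longrightarrow>
      (\<Sum>p\<in>P. emeasure \<mu> (E p) * (\<integral>\<^sup>+x. ennreal (hker (\<gamma> - b) r (y p) x *
         (hker \<gamma>' 1 x\<^sub>0 x + hker \<gamma>' 1 x\<^sub>0 (y p))) \<partial>\<mu>)) \<le> ennreal K4"
    using two_hker_sum[OF diamc_nonneg gb par(5)] by blast
  \<comment> \<open>Per level, cancellation contributes the power b of the mesh and the coefficient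
    of f the power s.\<close>
  define \<rho> where "\<rho> = \<delta> powr (b + s)"
  have \<rho>: "0 < \<rho>" "\<rho> < 1"
    using mesh_pos mesh_less_1 b powr_less_mono2[of "b + s" \<delta> 1] by (auto simp: \<rho>_def)
  \<comment> \<open>\<open>K0\<close> recentres the kernels at the sample points; \<open>K2\<close>
    pays for the level 0, where the kernel is integrated over a subcube instead of sampled.\<close>
  define C1 where "C1 = C * dblconst S * K0 * K2"
  define B0 where "B0 = 2 * A * dblconst S * C1"
  \<comment> \<open>Dividing by the N-th power of the ratio lets the geometric bound dominate the
    levels k <= N as well; 1 + K3 serves low and high levels alike.\<close>
  define B where "B = B0 * (1 + K3) / \<rho> ^ N"
  have C1: "0 < C1" unfolding C1_def using C dblconst_ge_1 K0(1) K2(1) by simp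
  have B0: "0 < B0" unfolding B0_def using C1 A_ge_1 dblconst_ge_1 by simp
  have B: "0 < B" unfolding B_def using B0 K3(1) \<rho> by (intro divide_pos_pos mult_pos_pos) auto
  show thesis
  proof (rule that[of "B * K4 * (1 / (1 - \<rho>))"])
    show "0 < B * K4 * (1 / (1 - \<rho>))" using B K4(1) \<rho> by simp
    fix f \<phi> c M
    assume f: "f \<in> dual S \<eta> \<beta> \<gamma>" and \<phi>0: "\<phi> \<in> test_space0 S \<eta> \<beta> \<gamma>"
      and \<phi>: "test_bound S \<beta>' \<gamma>' \<phi> c" and F: "F_norm S Q N s q f \<le> ennreal M" and M: "0 < M"
    have c: "0 < c" by (rule test_boundD(1)[OF \<phi>])
    \<comment> \<open>For k <= N the coefficients are averages, so any point of the subcube will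
      do.\<close>
    define good where "good k \<tau> u \<longleftrightarrow> u \<in> subcube S k \<tau> \<and>
      (N < k \<longrightarrow> cmod (Qf Q f k u) \<le> K3 * M * \<delta> powr (real k * s))" for k \<tau> u
    define y where "y k \<alpha> \<tau> = (SOME u. good k \<tau> u)" for k :: nat and \<alpha> \<tau> :: 'i
    have y: "good k \<tau> (y k \<alpha> \<tau>)" if "\<alpha> \<in> indices S (int k)" "\<tau> \<in> subidx S k \<alpha>" for k \<alpha> \<tau>
    proof -
      have "\<exists>u. good k \<tau> u"
      proof (cases "N < k")
        case True
        then show ?thesis using K3(2)[OF True that F M] by (auto simp: good_def)
      next
        case False
        then show ?thesis using subidxD(4)[OF that(2)] by (auto simp: good_def)
      qed
      then show ?thesis unfolding y_def by (rule someI_ex)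
    qed
    then have "\<forall>k. \<forall>\<alpha>\<in>indices S (int k). \<forall>\<tau>\<in>subidx S k \<alpha>. y k \<alpha> \<tau> \<in> subcube S k \<tau>"
      by (simp add: good_def)
    from Qt[OF this] obtain Qt where
      Qt1: "\<And>k u v. cmod (Qt k u v) \<le> C * poly_bound S \<gamma> k u v"
      and Qt2: "\<And>k. marginals S (Qt k) (if k \<le> N then 1 else 0)"
      and Qt3: "\<forall>f\<in>dual S \<eta> \<beta> \<gamma>. \<forall>\<phi>\<in>test_space0 S \<eta> \<beta> \<gamma>.
        \<exists>t. (\<forall>k. ((\<lambda>(\<alpha>, \<tau>). repr_term S Q N y Qt f \<phi> k \<alpha> \<tau>) has_sum t k) (subpairs k)) \<and>
            t sums f \<phi>"
      by (elim exE conjE) (rule that; blast)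
    obtain t where t: "\<And>k. ((\<lambda>(\<alpha>, \<tau>). repr_term S Q N y Qt f \<phi> k \<alpha> \<tau>) has_sum t k) (subpairs k)"
      and sums: "t sums f \<phi>"
      using Qt3 f \<phi>0 by blast
    \<comment> \<open>The pairing integrates over the first variable. The bound is therefore centred
      at the second one, the sample point, and measurable in the first.\<close>
    have Qt_size: "cmod (Qt k u v) \<le> C * dblconst S * K0 * hker \<gamma> (\<delta> ^ k) v u" for k u v
    proof -
      have "cmod (Qt k u v) \<le> C * poly_bound S \<gamma> k u v" by (rule Qt1)
      also have "\<dots> \<le> C * (dblconst S * (K0 * hker \<gamma> (\<delta> ^ k) v u))"
        using C dblconst_ge_1 mesh_power
        by (intro mult_left_mono order_trans[OF poly_bound_le_hker[OF mesh_pos]] K0(2)) auto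
      finally show ?thesis by (simp only: mult.assoc)
    qed
    have C1_le: "C * dblconst S * K0 \<le> C1"
      unfolding C1_def using mult_left_mono[OF K2(1), of "C * dblconst S * K0"] C dblconst_ge_1 K0(1)
      by simp
    have Qt_size1: "cmod (Qt k u v) \<le> C1 * hker \<gamma> (\<delta> ^ k) v u" for k u v
      by (rule order_trans[OF Qt_size]) (intro mult_right_mono C1_le hker_nonneg)
    let ?W = "\<lambda>k. B * c * M * \<rho> ^ k"
    have W_low: "B0 * c * M \<le> ?W k" if "k \<le> N" for k
    proof -
      have "\<rho> ^ N \<le> \<rho> ^ k" using \<rho> that by (intro power_decreasing) auto
      then have "1 * 1 \<le> (1 + K3) * (\<rho> ^ k / \<rho> ^ N)"
        using K3(1) \<rho> by (intro mult_mono) auto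
      then have "B0 * c * M * 1 \<le> B0 * c * M * ((1 + K3) * (\<rho> ^ k / \<rho> ^ N))"
        using B0 c M by (intro mult_left_mono) auto
      then show ?thesis by (simp add: B_def mult_ac)
    qed
    have W_high: "B0 * c * (\<delta> ^ k) powr b * (K3 * M * \<delta> powr (real k * s)) \<le> ?W k" for k
    proof -
      have "\<delta> powr (real k * b) * \<delta> powr (real k * s) = \<delta> powr ((b + s) * real k)"
        unfolding powr_add[symmetric] by (simp add: algebra_simps)
      moreover have "(\<delta> ^ k) powr b = \<delta> powr (real k * b)"
        using mesh_pos powr_powr[of \<delta> "real k" b] by (simp add: powr_realpow)
      moreover have "\<rho> ^ k = \<delta> powr ((b + s) * real k)"
        using \<rho>(1) powr_powr[of \<delta> "b + s" "real k"] by (simp add: powr_realpow \<rho>_def)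
      ultimately have \<rho>k: "(\<delta> ^ k) powr b * \<delta> powr (real k * s) = \<rho> ^ k" by simp
      have "B0 * c * (\<delta> ^ k) powr b * (K3 * M * \<delta> powr (real k * s))
          = B0 * c * M * ((\<delta> ^ k) powr b * \<delta> powr (real k * s)) * K3"
        by (simp only: mult_ac)
      also have "\<dots> = B0 * c * M * \<rho> ^ k * K3" by (simp only: \<rho>k)
      finally have eq: "B0 * c * (\<delta> ^ k) powr b * (K3 * M * \<delta> powr (real k * s))
          = B0 * c * M * \<rho> ^ k * K3" .
      have "\<rho> ^ N \<le> 1" using \<rho> by (intro power_le_one) auto
      then have "K3 * \<rho> ^ N \<le> K3" using K3(1) by simp
      then have "K3 \<le> (1 + K3) / \<rho> ^ N"
        using \<rho> by (simp add: pos_le_divide_eq)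
      then have "B0 * c * M * \<rho> ^ k * K3 \<le> B0 * c * M * \<rho> ^ k * ((1 + K3) / \<rho> ^ N)"
        using B0 c M \<rho> by (intro mult_left_mono) auto
      also have "\<dots> = ?W k" by (simp add: B_def mult_ac)
      finally show ?thesis unfolding eq .
    qed
    let ?J = "\<lambda>k \<alpha> \<tau>. emeasure \<mu> (subcube S k \<tau>) * pairing (\<gamma> - b) \<gamma>' (\<delta> ^ k) (y k \<alpha> \<tau>)"
    have summand: "ennreal (cmod (repr_term S Q N y Qt f \<phi> k \<alpha> \<tau>)) \<le> ennreal (?W k) * ?J k \<alpha> \<tau>"
      if \<alpha>: "\<alpha> \<in> indices S (int k)" and \<tau>: "\<tau> \<in> subidx S k \<alpha>" for k \<alpha> \<tau>
    proof -
      let ?E = "subcube S k \<tau>" and ?y = "y k \<alpha> \<tau>"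
      define m where "m = measure \<mu> ?E"
      have m: "0 \<le> m" "emeasure \<mu> ?E = ennreal m"
        using subcube_emeasure(3)[OF \<tau>] by (auto simp: m_def)
      have yE: "?y \<in> ?E" using y[OF \<alpha> \<tau>] by (simp add: good_def)
      have r: "0 < \<delta> ^ k" by (rule mesh_power)
      show ?thesis
      proof (cases "k = 0")
        case True
        let ?L = "\<lambda>x. LINT u:?E|\<mu>. Qt k x u"
        \<comment> \<open>The sample point serves as reference centre, to which
          \<open>hker_shift\<close> moves every \<open>u\<close> of the subcube; integration over
          the subcube produces the measure that the other levels carry as an explicit
          factor.\<close>
        have L: "cmod (?L x) \<le> (C1 * m) * hker \<gamma> (\<delta> ^ k) ?y x" for x
        proof -
          have "cmod (?L x) \<le> (C1 * hker \<gamma> (\<delta> ^ k) ?y x) * m"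
          proof (rule norm_set_integral_le_bound[OF subidxD(3)[OF \<tau>] m(2,1)])
            show "0 \<le> C1 * hker \<gamma> (\<delta> ^ k) ?y x" using C1 by simp
            fix u assume u: "u \<in> ?E"
            have "cmod (Qt k x u) \<le> C * poly_bound S \<gamma> k x u" by (rule Qt1)
            also have "\<dots> \<le> C * (dblconst S * (K2 * (K0 * hker \<gamma> (\<delta> ^ k) ?y x)))"
            proof (intro mult_left_mono order_trans[OF poly_bound_le_hker[OF mesh_pos]])
              have "hker \<gamma> (\<delta> ^ k) x u \<le> K2 * hker \<gamma> (\<delta> ^ k) x ?y"
                by (intro K2(2) r subcube_diam[OF \<tau> yE u])
              also have "\<dots> \<le> K2 * (K0 * hker \<gamma> (\<delta> ^ k) ?y x)"
                using K2(1) by (intro mult_left_mono K0(2) r) auto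
              finally show "hker \<gamma> (\<delta> ^ k) x u \<le> K2 * (K0 * hker \<gamma> (\<delta> ^ k) ?y x)" .
            qed (use C dblconst_ge_1 in auto)
            finally show "cmod (Qt k x u) \<le> C1 * hker \<gamma> (\<delta> ^ k) ?y x"
              unfolding C1_def by (simp only: mult_ac)
          qed
          then show ?thesis by (simp only: mult_ac)
        qed
        have "ennreal (cmod (\<integral>x. ?L x * \<phi> x \<partial>\<mu>))
            \<le> ennreal (2 * A * dblconst S * (C1 * m) * c) * pairing (\<gamma> - b) \<gamma>' (\<delta> ^ k) ?y"
          using C1 m b by (intro pairing_size[OF \<phi> L _ r]) auto
        also have "\<dots> = ennreal (B0 * c) * ?J k \<alpha> \<tau>"
        proof -
          have "2 * A * dblconst S * (C1 * m) * c = B0 * c * m" by (simp add: B0_def)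
          then show ?thesis
            unfolding m(2) using ennreal_mult''[OF m(1), of "B0 * c"] by (simp only: mult.assoc)
        qed
        finally have 1: "ennreal (cmod (\<integral>x. ?L x * \<phi> x \<partial>\<mu>)) \<le> ennreal (B0 * c) * ?J k \<alpha> \<tau>" .
        have "ennreal (cmod (\<integral>x. ?L x * \<phi> x \<partial>\<mu>) * cmod (mean S ?E (Qf Q f k)))
            \<le> ennreal (?W k) * ?J k \<alpha> \<tau>"
        proof (rule ennreal_mult_bound[OF 1])
          show "cmod (mean S ?E (Qf Q f k)) \<le> M"
            using True M by (intro mean_le_F_norm[OF _ \<alpha> \<tau> F]) auto
          show "B0 * c * M \<le> ?W k" using True by (intro W_low) simp
        qed (use B0 c in auto)
        then show ?thesis using True by (simp add: repr_term_def norm_mult)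
      next
        case False
        let ?I = "cmod (\<integral>x. Qt k x ?y * \<phi> x \<partial>\<mu>)"
        have step: "ennreal (m * ?I) \<le> ennreal D * ?J k \<alpha> \<tau>"
          if "ennreal ?I \<le> ennreal D * pairing (\<gamma> - b) \<gamma>' (\<delta> ^ k) ?y" for D
        proof -
          have "ennreal (m * ?I) = ennreal m * ennreal ?I" using m by (simp add: ennreal_mult)
          also have "\<dots> \<le> ennreal m * (ennreal D * pairing (\<gamma> - b) \<gamma>' (\<delta> ^ k) ?y)"
            by (intro mult_left_mono that) simp
          finally show ?thesis by (simp add: m(2) mult.left_commute)
        qed
        show ?thesis
        proof (cases "k \<le> N")
          case True
          have "ennreal ?I \<le> ennreal (2 * A * dblconst S * C1 * c) * pairing (\<gamma> - b) \<gamma>' (\<delta> ^ k) ?y"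
            using C1 b by (intro pairing_size[OF \<phi> Qt_size1 _ r]) auto
          then have 1: "ennreal (m * ?I) \<le> ennreal (B0 * c) * ?J k \<alpha> \<tau>"
            unfolding B0_def[symmetric] by (rule step)
          have "ennreal (m * ?I * cmod (mean S ?E (Qf Q f k))) \<le> ennreal (?W k) * ?J k \<alpha> \<tau>"
          proof (rule ennreal_mult_bound[OF 1])
            show "cmod (mean S ?E (Qf Q f k)) \<le> M"
              using True M by (intro mean_le_F_norm[OF _ \<alpha> \<tau> F]) auto
            show "B0 * c * M \<le> ?W k" using True by (rule W_low)
          qed (use B0 c m in auto)
          then show ?thesis using True False m(1) by (simp add: repr_term_def norm_mult m_def)
        next
          case high: False
          have "marginals S (Qt k) 0" using Qt2[of k] high by simp
          \<comment> \<open>Cancellation is used in the first variable, which is the second half of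
            \<open>marginals\<close>.\<close>
          then have int: "integrable \<mu> (\<lambda>x. Qt k x ?y)" "(\<integral>x. Qt k x ?y \<partial>\<mu>) = 0"
            unfolding marginals_def by blast+
          have "ennreal ?I \<le> ennreal (2 * A * dblconst S * C1 * c * (\<delta> ^ k) powr b)
              * pairing (\<gamma> - b) \<gamma>' (\<delta> ^ k) ?y"
            using C1 b by (intro pairing_cancellation[OF \<phi> Qt_size1 int _ r]) auto
          then have 1: "ennreal (m * ?I) \<le> ennreal (B0 * c * (\<delta> ^ k) powr b) * ?J k \<alpha> \<tau>"
            unfolding B0_def[symmetric] by (rule step)
          have "cmod (Qf Q f k ?y) \<le> K3 * M * \<delta> powr (real k * s)"
            using y[OF \<alpha> \<tau>] high by (simp add: good_def)
          then have "ennreal (m * ?I * cmod (Qf Q f k ?y)) \<le> ennreal (?W k) * ?J k \<alpha> \<tau>"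
            using B0 c m by (intro ennreal_mult_bound[OF 1 _ _ _ _ W_high]) auto
          then show ?thesis using False high m(1) by (simp add: repr_term_def norm_mult m_def)
        qed
      qed
    qed
    \<comment> \<open>\<open>has_sum\<close> is a limit along finite index sets, so a bound valid
      for every finite partial sum passes to \<open>t k\<close>.\<close>
    have "norm (t k) \<le> B * c * M * K4 * \<rho> ^ k" for k
    proof (rule Lim_norm_ubound[OF finite_subsets_at_top_neq_bot])
      show "(sum (\<lambda>(\<alpha>, \<tau>). repr_term S Q N y Qt f \<phi> k \<alpha> \<tau>) \<longlongrightarrow> t k)
          (finite_subsets_at_top (subpairs k))"
        using t[of k] by (simp add: has_sum_def)
      show "\<forall>\<^sub>F P in finite_subsets_at_top (subpairs k).
          norm (\<Sum>(\<alpha>, \<tau>)\<in>P. repr_term S Q N y Qt f \<phi> k \<alpha> \<tau>) \<le> B * c * M * K4 * \<rho> ^ k"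
      proof (rule eventually_finite_subsets_at_top_weakI)
        fix P assume P: "finite P" "P \<subseteq> subpairs k"
        let ?R = "\<lambda>p. repr_term S Q N y Qt f \<phi> k (fst p) (snd p)"
        let ?Y = "\<lambda>p. y k (fst p) (snd p)"
        have mem: "fst p \<in> indices S (int k)" "snd p \<in> subidx S k (fst p)" if "p \<in> P" for p
          using that P(2) by (auto simp: subpairs_def)
        have disj: "disjoint_family_on (\<lambda>p. subcube S k (snd p)) P"
          using subpairs_disjoint P(2) by (rule disjoint_family_on_mono[rotated])
        have "ennreal (norm (\<Sum>p\<in>P. ?R p)) \<le> ennreal (\<Sum>p\<in>P. norm (?R p))"
          by (intro ennreal_leI norm_sum)
        also have "\<dots> = (\<Sum>p\<in>P. ennreal (norm (?R p)))" by simp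
        also have "\<dots> \<le> (\<Sum>p\<in>P. ennreal (?W k) * ?J k (fst p) (snd p))"
          by (intro sum_mono summand mem)
        also have "\<dots> = ennreal (?W k) * (\<Sum>p\<in>P. ?J k (fst p) (snd p))"
          by (simp only: sum_distrib_left)
        also have "\<dots> \<le> ennreal (?W k) * ennreal K4"
        proof (intro mult_left_mono)
          show "(\<Sum>p\<in>P. ?J k (fst p) (snd p)) \<le> ennreal K4"
            unfolding pairing_def
          proof (rule K4(2)[where E = "\<lambda>p. subcube S k (snd p)" and y = ?Y,
                OF mesh_power P(1) disj])
            fix p assume p: "p \<in> P"
            show "subcube S k (snd p) \<in> sets \<mu>" by (rule subidxD(3)[OF mem(2)[OF p]])
            fix u assume "u \<in> subcube S k (snd p)"
            then show "d u (?Y p) \<le> diamc * \<delta> ^ k"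
              using y[OF mem[OF p]] by (intro subcube_diam[OF mem(2)[OF p]]) (auto simp: good_def)
          qed
        qed simp
        also have "\<dots> = ennreal (B * c * M * K4 * \<rho> ^ k)"
          using B c M \<rho> K4(1) by (simp add: ennreal_mult[symmetric] mult_ac)
        finally have "norm (\<Sum>p\<in>P. ?R p) \<le> B * c * M * K4 * \<rho> ^ k"
          using B c M \<rho> K4(1) by (subst (asm) ennreal_le_iff) auto
        then show "norm (\<Sum>(\<alpha>, \<tau>)\<in>P. repr_term S Q N y Qt f \<phi> k \<alpha> \<tau>) \<le> B * c * M * K4 * \<rho> ^ k"
          by (simp add: case_prod_beta)
      qed
    qed
    then have "norm (f \<phi>) \<le> B * c * M * K4 * (1 / (1 - \<rho>))"
      using \<rho> by (intro norm_sums_le[OF sums sums_mult[OF geometric_sums]]) auto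
    then show "cmod (f \<phi>) \<le> B * K4 * (1 / (1 - \<rho>)) * c * M" by (simp only: mult_ac)
  qed
qed

end

section \<open>Extension to the second space and the bound for its norm\<close>

theorem proposition5p11:
  fixes S :: "('a, 'i) hspace"
    and Q :: "nat \<Rightarrow> 'a \<Rightarrow> 'a \<Rightarrow> complex"
    and N :: nat
    and \<eta> \<beta> \<gamma> \<beta>' \<gamma>' s :: real
    and q :: ennreal
  assumes "homogeneous_type S" and "dyadic_points S" and "dyadic_cubes S"
    and "0 < \<eta>" and "\<eta> < 1"
    and "exp_IATI S \<eta> Q" and "reproducing S \<eta> Q N"
    and "\<beta> \<in> {0<..<\<eta>}" and "\<gamma> \<in> {0<..<\<eta>}"
    and "s \<in> {- min \<beta> \<gamma><..<min \<beta> \<gamma>}"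
    and "\<beta> \<in> {max (- s) 0<..<\<eta>}"
    and "ennreal (crit_index S s (min \<beta> \<gamma>)) < q"
    and "s \<in> {- min \<beta>' \<gamma>'<..<min \<beta>' \<gamma>'}"
    and "\<beta>' \<in> {max (- s) 0<..<\<eta>}" and "\<gamma>' \<in> {0<..<\<eta>}"
    and "ennreal (crit_index S s (min \<beta>' \<gamma>')) < q"
  shows "\<exists>C>0. \<forall>f\<in>F_space S \<eta> \<beta> \<gamma> Q N s q.
           (\<exists>!g. dual_extension S \<eta> \<beta>' \<gamma>' f g) \<and>
           dual_norm S \<eta> \<beta>' \<gamma>' (THE g. dual_extension S \<eta> \<beta>' \<gamma>' f g)
             \<le> C * enn2real (F_norm S Q N s q f)"
proof -
  interpret dyadic_space S using assms(1-3) by unfold_locales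
  \<comment> \<open>The midpoint of a nonempty interval: beta' exceeds the positive part of -s by
    the condition on beta', and gamma does so because gamma > 0 and s > -min(beta, gamma). Since
    beta' < eta < 1, also b < 1.\<close>
  define b where "b = (max (- s) 0 + min \<beta>' \<gamma>) / 2"
  have "max (- s) 0 < min \<beta>' \<gamma>" using assms(9,10,14) by auto
  then have b: "max (- s) 0 < b" "b < min \<beta>' \<gamma>" by (auto simp: b_def)
  have "0 < q" using assms(12) by (rule le_less_trans[OF zero_le])
  then obtain K where K: "0 < K"
    "\<And>f \<phi> c M. f \<in> dual S \<eta> \<beta> \<gamma> \<Longrightarrow> \<phi> \<in> test_space0 S \<eta> \<beta> \<gamma> \<Longrightarrow>
      test_bound S \<beta>' \<gamma>' \<phi> c \<Longrightarrow> F_norm S Q N s q f \<le> ennreal M \<Longrightarrow> 0 < M \<Longrightarrow>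
      cmod (f \<phi>) \<le> K * c * M"
    using reproducing_estimate[OF assms(7), of \<beta> \<gamma> \<gamma>' q b s \<beta>'] assms(5,8,9,14,15) b by auto
  let ?V = "test_space0 S \<eta> \<beta>' \<gamma>'" and ?W = "test_space S \<eta> \<eta>" and ?p = "test_norm S \<beta>' \<gamma>'"
  have le: "\<beta>' \<le> \<eta>" "\<gamma>' \<le> \<eta>" "\<beta> \<le> \<eta>" "\<gamma> \<le> \<eta>" using assms by auto
  interpret seminorm_dense ?V ?W ?p by (rule seminorm_dense_test_space[OF le(1,2)])
  have W0: "?W \<subseteq> test_space0 S \<eta> \<beta> \<gamma>" by (rule test_space_subset_test_space0[OF le(3,4)])
  show ?thesis
  proof (intro exI[of _ K] conjI ballI K(1))
    fix f assume "f \<in> F_space S \<eta> \<beta> \<gamma> Q N s q"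
    then have f: "f \<in> dual S \<eta> \<beta> \<gamma>" and fin: "F_norm S Q N s q f < \<infinity>"
      by (auto simp: F_space_def)
    define F where "F = enn2real (F_norm S Q N s q f)"
    have F: "F_norm S Q N s q f = ennreal F" "0 \<le> F"
      using fin by (auto simp: F_def)
    have lin: "linear_fun ?W f"
      using f W0 unfolding dual_def linear_fun_def by blast
    have bdd: "cmod (f \<phi>) \<le> K * F * ?p \<phi>" if "\<phi> \<in> ?W" for \<phi>
    proof -
      have T: "\<phi> \<in> test_space S \<beta>' \<gamma>'" using test_space_mono[OF le(1,2)] that by blast
      have p0: "0 \<le> ?p \<phi>" by (rule test_norm_nonneg[OF T])
      \<comment> \<open>Two limits are needed: the norm of the test function is an infimum, and the
        norm \<open>F\<close> of f may be 0 although \<open>reproducing_estimate\<close> wants a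
        positive bound.\<close>
      have 1: "cmod (f \<phi>) \<le> K * ?p \<phi> * M" if "F < M" for M
      proof (rule le_of_forall_pos_le_mult)
        fix e :: real assume "0 < e"
        then have "cmod (f \<phi>) \<le> K * (?p \<phi> + e) * M"
          using that F W0 \<open>\<phi> \<in> ?W\<close>
          by (intro K(2)[OF f] test_bound_of_norm_less[OF T]) (auto intro: ennreal_leI)
        then show "cmod (f \<phi>) \<le> K * ?p \<phi> * M + K * M * e" by (simp add: algebra_simps)
      qed (use K(1) that F(2) in auto)
      have "cmod (f \<phi>) \<le> K * ?p \<phi> * F"
      proof (rule le_of_forall_pos_le_mult)
        fix e :: real assume "0 < e"
        then show "cmod (f \<phi>) \<le> K * ?p \<phi> * F + K * ?p \<phi> * e"
          using 1[of "F + e"] by (simp add: distrib_left)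
      qed (use K(1) p0 in auto)
      then show ?thesis by (simp only: mult_ac)
    qed
    have KF: "0 \<le> K * F" using K(1) F(2) by simp
    have ext: "dual_extension S \<eta> \<beta>' \<gamma>' f g \<longleftrightarrow>
        g \<in> extensional ?V \<and> linear_fun ?V g \<and> (\<exists>C. \<forall>\<phi>\<in>?V. cmod (g \<phi>) \<le> C * ?p \<phi>) \<and>
        (\<forall>\<phi>\<in>?W. g \<phi> = f \<phi>)" for g
      by (simp add: dual_extension_def dual_def linear_fun_def conj_assoc)
    show ex1: "\<exists>!g. dual_extension S \<eta> \<beta>' \<gamma>' f g"
      unfolding ext by (rule ex1_bounded_extension[OF lin bdd KF])
    define g where "g = (THE g. dual_extension S \<eta> \<beta>' \<gamma>' f g)"
    have "dual_extension S \<eta> \<beta>' \<gamma>' f g" unfolding g_def by (rule theI'[OF ex1])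
    then have g: "cmod (g \<phi>) \<le> K * F * ?p \<phi>" if "\<phi> \<in> ?V" for \<phi>
      unfolding ext using bounded_extension_le[OF lin bdd KF] that by blast
    have "dual_norm S \<eta> \<beta>' \<gamma>' g \<le> K * F"
      unfolding dual_norm_def
    proof (rule cSup_least)
      \<comment> \<open>The supremum in \<open>dual_norm\<close> is a real one, so its set must be
        shown nonempty; the zero function is a witness.\<close>
      have "(\<lambda>x. 0) \<in> ?V" using W_sub zero_test_space by blast
      then show "{cmod (g \<phi>) |\<phi>. \<phi> \<in> ?V \<and> ?p \<phi> \<le> 1} \<noteq> {}"
        using test_norm_zero[of \<beta>' \<gamma>'] by fastforce
      fix z assume "z \<in> {cmod (g \<phi>) |\<phi>. \<phi> \<in> ?V \<and> ?p \<phi> \<le> 1}"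
      then obtain \<phi> where \<phi>: "z = cmod (g \<phi>)" "\<phi> \<in> ?V" "?p \<phi> \<le> 1" by blast
      have "z \<le> K * F * ?p \<phi>" using g[OF \<phi>(2)] \<phi>(1) by simp
      also have "\<dots> \<le> K * F * 1" by (intro mult_left_mono \<phi>(3) KF)
      finally show "z \<le> K * F" by simp
    qed
    then show "dual_norm S \<eta> \<beta>' \<gamma>' (THE g. dual_extension S \<eta> \<beta>' \<gamma>' f g)
        \<le> K * enn2real (F_norm S Q N s q f)"
      by (simp add: g_def F_def)
  qed
qed

end
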